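(* Let $\Xi=\mathbb{R}^k$ or $\Xi=\mathbb{R}^k_+$, let $x\in\mathbb{R}^{n_x}$, let the standing assumptions on the second-stage problem (complete recourse and $\Pi$ having an interior point) hold, and let $\epsilon>0$. Let $\Pi^*:=\arg\max_{\pi\in\Pi}\|\pi\|_q$ and, for $i\in[N]$, $\Pi^*_{i,x}:=\arg\max_{\pi\in\Pi}\pi^\top(Tx+\zeta^i)$. For $\pi^*\in\Pi^*$ let $$d_{\pi^*}:=\frac{(\pi^* )^{q-1}}{\|\pi^*\|_q^{q-1}}$$ (componentwise power). Then the worst-case expectation $\sup_{\mathbb{P}\in\mathcal{P}^1_{N,\epsilon}}\mathbb{E}_{\mathbb{P}}[Z(x,\tilde\xi)]$ is either attained or asymptotically attained by distributions that reallocate probability mass at a single sample point $\zeta^{i'}$ in the direction $d_{\pi^*}$, in the following precise sense. (i) Attainable case: if there exists $i'\in[N]$ with $\Pi^*\cap\Pi^*_{i',x}\neq\emptyset$, then for any $\pi^*\in\Pi^*\cap\Pi^*_{i',x}$ the distribution $$\mathbb{Q}_x=\frac1N\Big(\sum_{i\in[N]:\,i\ne i'}\delta_{\zeta^i}+\delta_{\zeta^{i'}+\epsilon N d_{\pi^*}}\Big)$$ belongs to $\mathcal{P}^1_{N,\epsilon}$ and attains $\sup_{\mathbb{P}\in\mathcal{P}^1_{N,\epsilon}}\mathbb{E}_{\mathbb{P}}[Z(x,\tilde\xi)]$. (ii) Asymptotically attainable case: if $\Pi^*\cap\Pi^*_{i,x}=\emptyset$ for all $i\in[N]$, then no $\mathbb{Q}\in\mathcal{P}^1_{N,\epsilon}$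 attains $\sup_{\mathbb{P}\in\mathcal{P}^1_{N,\epsilon}}\mathbb{E}_{\mathbb{P}}[Z(x,\tilde\xi)]$, and, for some $i'\in[N]$ and $\pi^*\in\Pi^*$, the distributions $$\mathbb{Q}_{x,\Delta}=\frac1N\sum_{i\in[N]:\,i\ne i'}\delta_{\zeta^i}+\Delta\,\delta_{\zeta^{i'}+\frac{\epsilon}{\Delta}d_{\pi^*}}+\Big(\frac1N-\Delta\Big)\delta_{\zeta^{i'}},\qquad \Delta\in(0,\tfrac1N],$$ all belong to $\mathcal{P}^1_{N,\epsilon}$ and satisfy $\lim_{\Delta\to0^+}\mathbb{E}_{\mathbb{Q}_{x,\Delta}}[Z(x,\tilde\xi)]=\sup_{\mathbb{P}\in\mathcal{P}^1_{N,\epsilon}}\mathbb{E}_{\mathbb{P}}[Z(x,\tilde\xi)]$.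
   Context: Setting. Let $n_x,n_y,k,N$ be positive integers, $[N]=\{1,\dots,N\}$. Let $\mathcal{K}_y\subseteq\mathbb{R}^{n_y}$ be a Cartesian product of finitely many proper cones, with dual cone $\mathcal{K}_y^*=\{v: v^\top y\ge 0\ \forall y\in\mathcal{K}_y\}$, and write $a\preceq_{\mathcal{K}_y^*}b$ for $b-a\in\mathcal{K}_y^*$. Let $\mathbf{q}\in\mathbb{R}^{n_y}$ (cost vector), $W\in\mathbb{R}^{k\times n_y}$, $T\in\mathbb{R}^{k\times n_x}$. For $x\in\mathbb{R}^{n_x}$, $\xi\in\mathbb{R}^k$ define the second-stage cost $$Z(x,\xi):=\inf_{y\in\mathcal{K}_y}\{\mathbf{q}^\top y: Wy\ge Tx+\xi\},$$ and the dual feasible set $\Pi:=\{\pi\in\mathbb{R}^k:\pi\ge0,\ W^\top\pi\preceq_{\mathcal{K}_y^*}\mathbf{q}\}$. Standing assumptions: (i) complete recourse: for every right-hand side $h\in\mathbb{R}^k$ there is $y\in\mathcal{K}_y$ with $Wy\ge h$; (ii) $\Pi$ has an interior point. (Under these, $\Pi$ is compact.) Norms: $\|\cdot\|$ is the $l_p$-norm on $\mathbb{R}^k$ for some fixed $p\in[1,\infty]$, and the scalar $q\in[1,\infty]$ satisfies $1/p+1/q=1$, so $\|\cdot\|_q$ is the dual norm. For a vector $v$ and scalar $a$, $v^a$ is the componentwise power. Conventions for extreme $q$: if $q=1$, $0^0=1$; if $q=\infty$, $d_\pi$ is read as the limit of the formula as $q\to\infty$, i.e. $(d_\pi)_j=1/m$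 for the $m$ indices $j$ at which $\pi_j=\|\pi\|_\infty$ and $(d_\pi)_j=0$ otherwise. Ambiguity set: given sample points $\zeta^1,\dots,\zeta^N\in\Xi$, let $\hat{\mathbb{P}}_N=\frac1N\sum_{i=1}^N\delta_{\zeta^i}$ ($\delta$ = Dirac measure). For $r\ge1$ let $\mathcal{P}^r(\Xi)$ be the set of Borel probability measures on $\Xi$ with finite $r$th moment, let $$W^r(\mathbb{Q}_1,\mathbb{Q}_2)=\inf_{\gamma}\Big(\int_{\Xi\times\Xi}\|\xi_1-\xi_2\|^r\,d\gamma(\xi_1,\xi_2)\Big)^{1/r}$$ where $\gamma$ ranges over couplings of $\mathbb{Q}_1,\mathbb{Q}_2$, and let $\mathcal{P}^r_{N,\epsilon}=\{\mathbb{Q}\in\mathcal{P}^r(\Xi):W^r(\mathbb{Q},\hat{\mathbb{P}}_N)\le\epsilon\}$. Here $\mathbb{E}_{\mathbb{P}}[Z(x,\tilde\xi)]=\int_\Xi Z(x,\xi)\,d\mathbb{P}(\xi)$. *)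

theory Defs
  imports "HOL-Probability.Probability"
begin

section \<open>Norms\<close>

text \<open>\<open>lp_norm p\<close> is a norm for \<open>p \<in> [1, \<infinity>]\<close>; other values of \<open>p\<close> are not used.\<close>

definition lp_norm :: "ereal \<Rightarrow> real ^ 'k \<Rightarrow> real" where
  "lp_norm p v =
     (if p = \<infinity> then infnorm v
      else (\<Sum>i\<in>UNIV. \<bar>v $ i\<bar> powr real_of_ereal p) powr (1 / real_of_ereal p))"


section \<open>Second-stage problem\<close>

text \<open>\<open>\<real>\<^sup>B\<close> for a set \<open>B\<close> of coordinates is realised as the subspace of vectors supported in \<open>B\<close>.
  The interior in \<open>proper_cone_in\<close> is relative to that subspace.\<close>

definition coord_subspace :: "'n set \<Rightarrow> (real ^ 'n) set" where
  "coord_subspace B = {y. \<forall>i. i \<notin> B \<longrightarrow> y $ i = 0}"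

definition coord_proj :: "'n set \<Rightarrow> real ^ 'n \<Rightarrow> real ^ 'n" where
  "coord_proj B y = (\<chi> i. if i \<in> B then y $ i else 0)"

definition proper_cone_in :: "(real ^ 'n) set \<Rightarrow> (real ^ 'n) set \<Rightarrow> bool" where
  "proper_cone_in S C \<longleftrightarrow>
     C \<subseteq> S \<and> convex_cone C \<and> closed C \<and>
     (\<forall>y. y \<in> C \<and> - y \<in> C \<longrightarrow> y = 0) \<and>
     (top_of_set S) interior_of C \<noteq> {}"

definition product_of_proper_cones :: "(real ^ 'n) set \<Rightarrow> bool" where
  "product_of_proper_cones K \<longleftrightarrow>
     (\<exists>P C. partition_on UNIV P \<and>
            (\<forall>B\<in>P. proper_cone_in (coord_subspace B) (C B)) \<and>
            K = {y. \<forall>B\<in>P. coord_proj B y \<in> C B})"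

definition dual_cone :: "(real ^ 'n) set \<Rightarrow> (real ^ 'n) set" where
  "dual_cone K = {v. \<forall>y\<in>K. 0 \<le> v \<bullet> y}"

definition cone_le :: "(real ^ 'n) set \<Rightarrow> real ^ 'n \<Rightarrow> real ^ 'n \<Rightarrow> bool" where
  "cone_le C a b \<longleftrightarrow> b - a \<in> C"

text \<open>The infimum is taken in the reals: complete recourse makes the feasible set nonempty, and any
  dual feasible point bounds the objective from below. The order on vectors is componentwise.\<close>

definition second_stage_cost ::
  "real ^ 'ny \<Rightarrow> real ^ 'ny ^ 'k \<Rightarrow> real ^ 'nx ^ 'k \<Rightarrow> (real ^ 'ny) set \<Rightarrow> real ^ 'nx \<Rightarrow> real ^ 'k \<Rightarrow> real"
where
  "second_stage_cost c W T K x \<xi> = (INF y\<in>{y \<in> K. T *v x + \<xi> \<le> W *v y}. c \<bullet> y)"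

definition complete_recourse :: "real ^ 'ny ^ 'k \<Rightarrow> (real ^ 'ny) set \<Rightarrow> bool" where
  "complete_recourse W K \<longleftrightarrow> (\<forall>h. \<exists>y\<in>K. h \<le> W *v y)"

definition dual_feasible ::
  "real ^ 'ny \<Rightarrow> real ^ 'ny ^ 'k \<Rightarrow> (real ^ 'ny) set \<Rightarrow> (real ^ 'k) set" where
  "dual_feasible c W K = {\<pi>. 0 \<le> \<pi> \<and> cone_le (dual_cone K) (transpose W *v \<pi>) c}"

definition argmax_set :: "('a \<Rightarrow> real) \<Rightarrow> 'a set \<Rightarrow> 'a set" where
  "argmax_set f S = {\<pi>. is_arg_max f (\<lambda>\<pi>'. \<pi>' \<in> S) \<pi>}"

text \<open>In Isabelle \<open>0 powr 0 = 0\<close>, hence the separate case \<open>q = 1\<close>, which implements \<open>0\<^sup>0 = 1\<close> (also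
  \<open>\<parallel>\<pi>\<parallel>\<close> to the power \<open>0\<close> is \<open>1\<close>). The case \<open>q = \<infinity>\<close> is the limit of the formula as \<open>q\<close> tends to
  infinity.\<close>

definition direction :: "ereal \<Rightarrow> real ^ 'k \<Rightarrow> real ^ 'k" where
  "direction q \<pi> =
     (if q = \<infinity> then
        (\<chi> j. if \<pi> $ j = infnorm \<pi> then 1 / real (card {i. \<pi> $ i = infnorm \<pi>}) else 0)
      else if q = 1 then (\<chi> j. 1)
      else (\<chi> j. (\<pi> $ j) powr (real_of_ereal q - 1) / lp_norm q \<pi> powr (real_of_ereal q - 1)))"


section \<open>Wasserstein ambiguity set\<close>

text \<open>Probability measures on a set \<open>\<Xi>\<close> live on the trace of the Borel sigma-algebra, so their
  underlying space is \<open>\<Xi>\<close> itself.\<close>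

abbreviation borel_on :: "(real ^ 'k) set \<Rightarrow> (real ^ 'k) measure" where
  "borel_on \<Xi> \<equiv> restrict_space borel \<Xi>"

definition prob_with_moment :: "ereal \<Rightarrow> real \<Rightarrow> (real ^ 'k) set \<Rightarrow> (real ^ 'k) measure set" where
  "prob_with_moment p r \<Xi> =
     {Q. sets Q = sets (borel_on \<Xi>) \<and> prob_space Q \<and>
         (\<integral>\<^sup>+ \<xi>. ennreal (lp_norm p \<xi> powr r) \<partial>Q) < \<infinity>}"

definition couplings :: "'a measure \<Rightarrow> 'b measure \<Rightarrow> ('a \<times> 'b) measure set" where
  "couplings Q1 Q2 =
     {\<gamma>. sets \<gamma> = sets (Q1 \<Otimes>\<^sub>M Q2) \<and> prob_space \<gamma> \<and>
         distr \<gamma> Q1 fst = Q1 \<and> distr \<gamma> Q2 snd = Q2}"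

text \<open>Only used with positive exponents.\<close>

definition ennreal_powr :: "ennreal \<Rightarrow> real \<Rightarrow> ennreal" where
  "ennreal_powr t a = (if t = \<infinity> then \<infinity> else ennreal (enn2real t powr a))"

definition wasserstein ::
  "ereal \<Rightarrow> real \<Rightarrow> (real ^ 'k) measure \<Rightarrow> (real ^ 'k) measure \<Rightarrow> ennreal" where
  "wasserstein p r Q1 Q2 =
     (INF \<gamma>\<in>couplings Q1 Q2.
        ennreal_powr (\<integral>\<^sup>+ z. ennreal (lp_norm p (fst z - snd z) powr r) \<partial>\<gamma>) (1 / r))"

text \<open>The pushforward along \<open>z\<close> of the measure on the finite set \<open>I\<close> with weights \<open>w\<close>, that is the
  weighted sum over \<open>i \<in> I\<close> of Dirac measures at \<open>z i\<close>.\<close>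

definition dirac_mixture ::
  "(real ^ 'k) set \<Rightarrow> 'i set \<Rightarrow> ('i \<Rightarrow> real) \<Rightarrow> ('i \<Rightarrow> real ^ 'k) \<Rightarrow> (real ^ 'k) measure" where
  "dirac_mixture \<Xi> I w z = distr (point_measure I (\<lambda>i. ennreal (w i))) (borel_on \<Xi>) z"

lemma emeasure_dirac_mixture:
  assumes "finite I" "\<And>i. i \<in> I \<Longrightarrow> z i \<in> \<Xi>" "A \<in> sets (borel_on \<Xi>)"
  shows "emeasure (dirac_mixture \<Xi> I w z) A =
           (\<Sum>i\<in>I. ennreal (w i) * emeasure (return (borel_on \<Xi>) (z i)) A)"
proof -
  have m: "z \<in> measurable (point_measure I (\<lambda>i. ennreal (w i))) (borel_on \<Xi>)"
    using assms(2) by (auto simp: space_restrict_space)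
  have "emeasure (dirac_mixture \<Xi> I w z) A =
      emeasure (point_measure I (\<lambda>i. ennreal (w i))) (z -` A \<inter> I)"
    unfolding dirac_mixture_def
    by (subst emeasure_distr[OF m assms(3)]) (simp add: space_point_measure)
  also have "\<dots> = (\<Sum>i\<in>z -` A \<inter> I. ennreal (w i))"
    using assms(1) by (intro emeasure_point_measure_finite) auto
  also have "\<dots> = (\<Sum>i\<in>I. ennreal (w i) * indicator A (z i))"
    using assms(1) by (intro sum.mono_neutral_cong_left) (auto simp: indicator_def)
  finally show ?thesis
    using assms(3) by simp
qed

definition empirical :: "(real ^ 'k) set \<Rightarrow> nat \<Rightarrow> (nat \<Rightarrow> real ^ 'k) \<Rightarrow> (real ^ 'k) measure" where
  "empirical \<Xi> N \<zeta> = dirac_mixture \<Xi> {1..N} (\<lambda>_. 1 / real N) \<zeta>"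

definition ambiguity_set ::
  "ereal \<Rightarrow> real \<Rightarrow> (real ^ 'k) set \<Rightarrow> nat \<Rightarrow> (nat \<Rightarrow> real ^ 'k) \<Rightarrow> real \<Rightarrow> (real ^ 'k) measure set" where
  "ambiguity_set p r \<Xi> N \<zeta> \<epsilon> =
     {Q \<in> prob_with_moment p r \<Xi>. wasserstein p r Q (empirical \<Xi> N \<zeta>) \<le> ennreal \<epsilon>}"

text \<open>Extended-real valued, so that no boundedness is presupposed by the supremum.\<close>

definition worst_case :: "(real ^ 'k) measure set \<Rightarrow> (real ^ 'k \<Rightarrow> real) \<Rightarrow> ereal" where
  "worst_case \<P> f = (SUP P\<in>\<P>. ereal (\<integral>\<xi>. f \<xi> \<partial>P))"

definition attains_worst_case ::
  "(real ^ 'k) measure set \<Rightarrow> (real ^ 'k \<Rightarrow> real) \<Rightarrow> (real ^ 'k) measure \<Rightarrow> bool" where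
  "attains_worst_case \<P> f Q \<longleftrightarrow> Q \<in> \<P> \<and> ereal (\<integral>\<xi>. f \<xi> \<partial>Q) = worst_case \<P> f"

definition shifted_distribution ::
  "(real ^ 'k) set \<Rightarrow> nat \<Rightarrow> (nat \<Rightarrow> real ^ 'k) \<Rightarrow> real \<Rightarrow> nat \<Rightarrow> real ^ 'k \<Rightarrow> (real ^ 'k) measure" where
  "shifted_distribution \<Xi> N \<zeta> \<epsilon> i' d =
     dirac_mixture \<Xi> {1..N} (\<lambda>_. 1 / real N) (\<zeta>(i' := \<zeta> i' + (\<epsilon> * real N) *\<^sub>R d))"

text \<open>The index \<open>0\<close> carries the additional atom of mass \<open>\<Delta>\<close> split off from sample point \<open>i'\<close>.\<close>

definition split_distribution ::
  "(real ^ 'k) set \<Rightarrow> nat \<Rightarrow> (nat \<Rightarrow> real ^ 'k) \<Rightarrow> real \<Rightarrow> nat \<Rightarrow> real ^ 'k \<Rightarrow> real \<Rightarrow> (real ^ 'k) measure"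
where
  "split_distribution \<Xi> N \<zeta> \<epsilon> i' d \<Delta> =
     dirac_mixture \<Xi> {0..N} ((\<lambda>_. 1 / real N)(i' := 1 / real N - \<Delta>, 0 := \<Delta>))
       (\<zeta>(0 := \<zeta> i' + (\<epsilon> / \<Delta>) *\<^sub>R d))"

end

theory Submission
  imports Defs
begin

text \<open>
  Conic duality turns the second-stage cost into a support function,
  \<open>Z x \<xi> = (MAX \<pi> \<in> \<Pi>. \<pi> \<bullet> (T *v x + \<xi>))\<close>, where \<open>\<Pi>\<close> is the dual feasible set
  (\<open>second_stage_strong_duality\<close>). Complete recourse makes \<open>\<Pi>\<close> compact, so
  \<open>M = (MAX \<pi> \<in> \<Pi>. \<parallel>\<pi>\<parallel>\<^sub>q)\<close> exists, and by Hoelder's inequality \<open>M\<close> is a Lipschitz constant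
  of \<open>Z x\<close> for the \<open>p\<close>-norm.

  Integrating the Lipschitz inequality against a nearly optimal coupling bounds the worst case from
  above by \<open>U\<close>, the expectation of \<open>Z x\<close> under the empirical distribution plus \<open>M \<cdot> \<epsilon>\<close>
  (\<open>kantorovich_upper_bound\<close>). The bound \<open>U\<close> is the worst case: the direction \<open>d\<close> of a maximiser
  \<open>\<pi>\<close> of the \<open>q\<close>-norm is the equality case of Hoelder's inequality, that is \<open>\<parallel>d\<parallel>\<^sub>p = 1\<close> and
  \<open>\<pi> \<bullet> d = M\<close>, so along the ray from a sample point \<open>\<zeta> i\<close> the cost is at least
  \<open>\<pi> \<bullet> (T *v x + \<zeta> i) + t * M\<close>. If \<open>\<pi>\<close> is also optimal at \<open>\<zeta> i\<close>, this ray starts at the value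
  \<open>Z x (\<zeta> i)\<close>, and moving the whole atom spends the budget at rate exactly \<open>M\<close>. If it is not, there
  is a fixed deficit at the start of the ray, and moving a mass \<open>\<Delta>\<close> by \<open>\<epsilon> / \<Delta>\<close> loses only \<open>\<Delta>\<close> times
  that deficit, which vanishes as \<open>\<Delta>\<close> tends to \<open>0\<close>. The direction is nonnegative, so the ray stays
  in the orthant when \<open>\<Xi>\<close> is the orthant.

  For non-attainment, suppose that no maximiser of the \<open>q\<close>-norm is optimal at a sample point. By
  compactness of \<open>\<Pi>\<close>, the two defects \<open>M - \<parallel>\<pi>\<parallel>\<^sub>q\<close> and \<open>Z x (\<zeta> i) - \<pi> \<bullet> (T *v x + \<zeta> i)\<close> have a sum
  bounded below on \<open>\<Pi>\<close> by some \<open>s > 0\<close>, which improves the Lipschitz inequality at the sample points by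
  \<open>s * min 1 \<parallel>z - \<zeta> i\<parallel>\<^sub>p\<close> (\<open>support_function_slack\<close>). A distribution of value \<open>U\<close> would have couplings
  of cost close to \<open>\<epsilon>\<close> for which the truncated cost tends to \<open>0\<close>; since the transport cost
  is dominated by a function that is integrable under the first marginal alone, the full
  cost would tend to \<open>0\<close> as well, although it is at least \<open>\<epsilon>\<close> (\<open>kantorovich_bound_strict\<close>).
  Working with nearly optimal couplings replaces the compactness argument that yields an optimal one.
\<close>

section \<open>The norms and the direction of steepest growth\<close>

lemma lp_norm_ereal:
  "lp_norm (ereal r) v = (\<Sum>i\<in>UNIV. \<bar>v $ i\<bar> powr r) powr (1 / r)"
  by (simp add: lp_norm_def)

lemma lp_exponent_cases:
  assumes "1 \<le> (p::ereal)"
  obtains "p = \<infinity>" | r where "p = ereal r" "1 \<le> r"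
  using assms by (cases p) auto

lemma conjugate_exponent_cases:
  assumes "1 \<le> (p::ereal)" "1 \<le> q" "1 / p + 1 / q = 1"
  obtains "p = 1" "q = \<infinity>" | "p = \<infinity>" "q = 1"
    | r s where "p = ereal r" "q = ereal s" "1 < r" "1 < s" "1 / r + 1 / s = 1"
proof (cases p; cases q)
  fix r s assume *: "p = ereal r" "q = ereal s"
  then have rs: "1 \<le> r" "1 \<le> s" using assms by auto
  have eq: "1 / r + 1 / s = 1"
    using assms(3) rs * by (simp add: one_ereal_def)
  have "1 / s > 0" "1 / r > 0" using rs by auto
  then have "1 / r < 1" "1 / s < 1" using eq by linarith+
  then have "1 < r" "1 < s" using rs by (auto simp: divide_simps)
  with * eq that(3) show thesis by blast
next
  fix r assume *: "p = ereal r" "q = \<infinity>"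
  then have "r \<ge> 1" using assms by auto
  moreover have "1 / r = 1" using assms(3) * calculation by (simp add: one_ereal_def)
  ultimately have "r = 1" by (simp add: divide_simps)
  then show thesis using * that(1) by simp
next
  fix r assume *: "p = \<infinity>" "q = ereal r"
  then have "r \<ge> 1" using assms by auto
  moreover have "1 / r = 1" using assms(3) * calculation by (simp add: one_ereal_def)
  ultimately have "r = 1" by (simp add: divide_simps)
  then show thesis using * that(2) by simp
qed (use assms in auto)

lemma infnorm_attained_cart:
  fixes v :: "real ^ 'k"
  obtains j where "infnorm v = \<bar>v $ j\<bar>"
proof -
  have "infnorm v \<in> (\<lambda>b. \<bar>v \<bullet> b\<bar>) ` Basis"
    unfolding infnorm_Max by (intro Max_in) auto
  then obtain b where "b \<in> Basis" "infnorm v = \<bar>v \<bullet> b\<bar>" by blast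
  then show ?thesis using that by (auto simp: Basis_vec_def inner_axis)
qed

lemma lp_norm_nonneg [simp]: "0 \<le> lp_norm p v"
  by (simp add: lp_norm_def infnorm_pos_le)

lemma lp_norm_minus [simp]: "lp_norm p (- v) = lp_norm p v"
  by (simp add: lp_norm_def infnorm_neg)

lemma lp_norm_scaleR:
  assumes "1 \<le> p"
  shows "lp_norm p (t *\<^sub>R v) = \<bar>t\<bar> * lp_norm p v"
  using assms
proof (cases rule: lp_exponent_cases)
  case 1
  then show ?thesis by (simp add: lp_norm_def infnorm_mul)
next
  case (2 r)
  have "(\<Sum>i\<in>UNIV. \<bar>(t *\<^sub>R v) $ i\<bar> powr r) = \<bar>t\<bar> powr r * (\<Sum>i\<in>UNIV. \<bar>v $ i\<bar> powr r)"
    by (simp add: abs_mult powr_mult sum_distrib_left)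
  then show ?thesis
    using 2 by (simp add: lp_norm_ereal powr_mult powr_powr sum_nonneg)
qed

text \<open>Comparison with the maximum norm transfers integrability and continuity between \<open>lp_norm\<close> and the
  Euclidean norm; a dimension-dependent constant in the reverse comparison is harmless for that.\<close>

lemma infnorm_le_lp_norm:
  assumes "1 \<le> p"
  shows "infnorm v \<le> lp_norm p v"
  using assms
proof (cases rule: lp_exponent_cases)
  case 1
  then show ?thesis by (simp add: lp_norm_def)
next
  case (2 r)
  obtain j where j: "infnorm v = \<bar>v $ j\<bar>" by (rule infnorm_attained_cart)
  have "\<bar>v $ j\<bar> = (\<bar>v $ j\<bar> powr r) powr (1 / r)"
    using 2 by (simp add: powr_powr)
  also have "\<dots> \<le> (\<Sum>i\<in>UNIV. \<bar>v $ i\<bar> powr r) powr (1 / r)"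
    using 2 by (intro powr_mono2 member_le_sum) auto
  finally show ?thesis using j 2 by (simp add: lp_norm_ereal)
qed

lemma lp_norm_le_infnorm:
  fixes v :: "real ^ 'k"
  assumes "1 \<le> p"
  shows "lp_norm p v \<le> real CARD('k) * infnorm v"
  using assms
proof (cases rule: lp_exponent_cases)
  case 1
  have "1 * infnorm v \<le> real CARD('k) * infnorm v"
    by (intro mult_right_mono) (auto simp: infnorm_pos_le Suc_leI)
  then show ?thesis using 1 by (simp add: lp_norm_def)
next
  case (2 r)
  have "(\<Sum>i\<in>UNIV. \<bar>v $ i\<bar> powr r) \<le> (\<Sum>i\<in>(UNIV::'k set). infnorm v powr r)"
    using 2 by (intro sum_mono powr_mono2) (auto simp: component_le_infnorm_cart)
  then have "lp_norm p v \<le> (real CARD('k) * infnorm v powr r) powr (1 / r)"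
    using 2 by (auto simp: lp_norm_ereal intro!: powr_mono2 sum_nonneg)
  also have "\<dots> = real CARD('k) powr (1 / r) * infnorm v"
    using 2 by (simp add: powr_mult powr_powr infnorm_pos_le)
  also have "\<dots> \<le> real CARD('k) powr 1 * infnorm v"
    using 2 by (intro mult_right_mono powr_mono) (auto simp: infnorm_pos_le Suc_leI)
  finally show ?thesis by simp
qed

lemma lp_norm_pos_iff:
  assumes "1 \<le> p"
  shows "0 < lp_norm p v \<longleftrightarrow> v \<noteq> 0"
proof
  assume "0 < lp_norm p v"
  then show "v \<noteq> 0" using lp_norm_le_infnorm[OF assms, of v] by (auto simp: infnorm_0)
next
  assume "v \<noteq> 0"
  then show "0 < lp_norm p v"
    using infnorm_le_lp_norm[OF assms, of v] infnorm_pos_lt[of v] by linarith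
qed

lemma continuous_on_lp_norm [continuous_intros]:
  assumes "1 \<le> p" "continuous_on S f"
  shows "continuous_on S (\<lambda>x. lp_norm p (f x))"
  using assms(1)
proof (cases rule: lp_exponent_cases)
  case 1
  then show ?thesis
    using continuous_on_compose2[OF continuous_on_infnorm[of UNIV id, simplified] assms(2)]
    by (simp add: lp_norm_def continuous_on_infnorm assms)
next
  case (2 r)
  then show ?thesis
    unfolding 2(1) lp_norm_ereal
    by (intro continuous_on_powr' continuous_intros assms) (auto intro: sum_nonneg)
qed

lemma lp_norm_powr_sum:
  assumes "0 < r"
  shows "(\<Sum>i\<in>UNIV. \<bar>v $ i\<bar> powr r) = lp_norm (ereal r) v powr r"
  using assms by (simp add: lp_norm_ereal powr_powr sum_nonneg)

lemma inner_le_l1_infnorm: 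
  fixes a b :: "real ^ 'k"
  shows "a \<bullet> b \<le> lp_norm 1 a * lp_norm \<infinity> b"
proof -
  have "a \<bullet> b = (\<Sum>i\<in>UNIV. a $ i * b $ i)" by (simp add: inner_vec_def)
  also have "\<dots> \<le> (\<Sum>i\<in>UNIV. \<bar>a $ i\<bar> * infnorm b)"
  proof (intro sum_mono)
    fix i
    have "a $ i * b $ i \<le> \<bar>a $ i\<bar> * \<bar>b $ i\<bar>" by (metis abs_ge_self abs_mult)
    also have "\<dots> \<le> \<bar>a $ i\<bar> * infnorm b"
      by (intro mult_left_mono) (auto simp: component_le_infnorm_cart)
    finally show "a $ i * b $ i \<le> \<bar>a $ i\<bar> * infnorm b" .
  qed
  finally show ?thesis
    by (simp add: lp_norm_def one_ereal_def sum_distrib_right sum_nonneg)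
qed

text \<open>For finite exponents this is Young's inequality, summed over the coordinates of the normalised
  vectors; the two extreme pairs of exponents are the elementary bound by the maximum norm.\<close>

lemma Holder_inequality_lp:
  fixes a b :: "real ^ 'k"
  assumes "1 \<le> p" "1 \<le> q" "1 / p + 1 / q = 1"
  shows "a \<bullet> b \<le> lp_norm p a * lp_norm q b"
  using assms
proof (cases rule: conjugate_exponent_cases)
  case 1
  then show ?thesis using inner_le_l1_infnorm by simp
next
  case 2
  then show ?thesis using inner_le_l1_infnorm[of b a] by (simp add: inner_commute mult.commute)
next
  case (3 r s)
  show ?thesis
  proof (cases "a = 0 \<or> b = 0")
    case True
    then show ?thesis by (auto simp: mult_nonneg_nonneg)
  next
    case False
    define A B where "A = lp_norm p a" and "B = lp_norm q b"
    have AB: "0 < A" "0 < B"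
      using False assms by (auto simp: A_def B_def lp_norm_pos_iff)
    have "a \<bullet> b / (A * B) = (\<Sum>i\<in>UNIV. (a $ i / A) * (b $ i / B))"
      by (simp add: inner_vec_def sum_divide_distrib)
    also have "\<dots> \<le> (\<Sum>i\<in>UNIV. (\<bar>a $ i\<bar> / A) powr r / r + (\<bar>b $ i\<bar> / B) powr s / s)"
    proof (intro sum_mono)
      fix i
      have "(a $ i / A) * (b $ i / B) \<le> (\<bar>a $ i\<bar> / A) * (\<bar>b $ i\<bar> / B)"
        using abs_ge_self[of "(a $ i / A) * (b $ i / B)"] AB by (simp add: abs_mult)
      also have "\<dots> \<le> (\<bar>a $ i\<bar> / A) powr r / r + (\<bar>b $ i\<bar> / B) powr s / s"
        using AB 3 by (intro Youngs_inequality) auto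
      finally show "(a $ i / A) * (b $ i / B) \<le> \<dots>" .
    qed
    also have "\<dots> = (\<Sum>i\<in>UNIV. \<bar>a $ i\<bar> powr r) / A powr r / r
        + (\<Sum>i\<in>UNIV. \<bar>b $ i\<bar> powr s) / B powr s / s"
      using AB by (simp add: powr_divide sum.distrib sum_divide_distrib)
    also have "\<dots> = 1"
      using AB 3 by (simp add: lp_norm_powr_sum flip: A_def[unfolded 3(1)] B_def[unfolded 3(2)])
    finally show ?thesis using AB by (simp add: A_def B_def divide_simps)
  qed
qed

lemma direction_nonneg:
  shows "0 \<le> direction q \<pi>"
  by (auto simp: direction_def less_eq_vec_def)

text \<open>For nonnegative \<open>\<pi>\<close> the direction is the equality case of Hoelder's inequality: among the
  vectors of \<open>p\<close>-norm \<open>1\<close> it maximises the inner product with \<open>\<pi>\<close>.\<close>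

lemma
  fixes \<pi> :: "real ^ 'k"
  assumes pq: "1 \<le> p" "1 \<le> q" "1 / p + 1 / q = 1" and \<pi>: "0 \<le> \<pi>" "\<pi> \<noteq> 0"
  shows lp_norm_direction: "lp_norm p (direction q \<pi>) = 1" (is ?A)
    and inner_direction: "\<pi> \<bullet> direction q \<pi> = lp_norm q \<pi>" (is ?B)
proof -
  have nn: "0 \<le> \<pi> $ i" for i using \<pi> by (simp add: less_eq_vec_def)
  from pq have "?A \<and> ?B"
  proof (cases rule: conjugate_exponent_cases)
    case 1
    define m where "m = real (card {i. \<pi> $ i = infnorm \<pi>})"
    obtain j where "infnorm \<pi> = \<bar>\<pi> $ j\<bar>" by (rule infnorm_attained_cart)
    then have jm: "j \<in> {i. \<pi> $ i = infnorm \<pi>}" using nn by simp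
    then have m: "0 < m" unfolding m_def
      by (metis card_gt_0_iff empty_iff finite of_nat_0_less_iff)
    have d: "direction q \<pi> = (\<chi> j. if \<pi> $ j = infnorm \<pi> then 1 / m else 0)"
      unfolding m_def using 1 by (simp add: direction_def)
    have "(\<Sum>j\<in>UNIV. \<bar>direction q \<pi> $ j\<bar>) = (\<Sum>j\<in>UNIV. if \<pi> $ j = infnorm \<pi> then 1 / m else 0)"
      using m by (auto simp: d intro!: sum.cong)
    also have "\<dots> = 1" using m by (simp add: sum.If_cases flip: m_def)
    finally have A: ?A using 1 by (simp add: lp_norm_def one_ereal_def)
    have "\<pi> \<bullet> direction q \<pi> = (\<Sum>j\<in>UNIV. if \<pi> $ j = infnorm \<pi> then infnorm \<pi> / m else 0)"
      by (auto simp: inner_vec_def d intro!: sum.cong)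
    also have "\<dots> = infnorm \<pi>" using m by (simp add: sum.If_cases flip: m_def)
    finally show ?thesis using A 1 by (simp add: lp_norm_def)
  next
    case 2
    have d: "direction q \<pi> = (\<chi> j. 1)" using 2 by (simp add: direction_def)
    obtain j where "infnorm (direction q \<pi>) = \<bar>direction q \<pi> $ j\<bar>" by (rule infnorm_attained_cart)
    then have ?A using 2 unfolding d by (simp add: lp_norm_def)
    moreover have ?B
      unfolding d using 2 nn by (simp add: inner_vec_def lp_norm_def one_ereal_def sum_nonneg)
    ultimately show ?thesis by blast
  next
    case (3 r s)
    define B where "B = lp_norm q \<pi>"
    have B: "0 < B" using \<pi> pq by (simp add: B_def lp_norm_pos_iff)
    have d: "direction q \<pi> = (\<chi> j. (\<pi> $ j) powr (s - 1) / B powr (s - 1))"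
      using 3 by (simp add: direction_def B_def one_ereal_def)
    have S: "(\<Sum>j\<in>UNIV. (\<pi> $ j) powr s) = B powr s"
      using lp_norm_powr_sum[of s \<pi>] 3 nn by (simp add: B_def)
    \<comment> \<open>Conjugacy of the exponents makes the \<open>r\<close>-th powers of the direction sum to
      \<open>(\<Sum>j. (\<pi> $ j) powr s) / B powr s = 1\<close>.\<close>
    have rs: "(s - 1) * r = s" using 3 by (simp add: field_simps)
    have "(\<Sum>j\<in>UNIV. \<bar>direction q \<pi> $ j\<bar> powr r) = (\<Sum>j\<in>UNIV. (\<pi> $ j) powr s / B powr s)"
      using B nn by (simp add: d powr_divide powr_powr rs)
    also have "\<dots> = 1" using B by (simp add: S flip: sum_divide_distrib)
    finally have A: ?A using 3 by (simp add: lp_norm_ereal)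
    have *: "t * (t powr (s - 1) / B powr (s - 1)) = t powr s / B powr (s - 1)" if "0 \<le> t" for t
      using that by (cases "t = 0") (auto simp: powr_diff)
    have "\<pi> \<bullet> direction q \<pi> = (\<Sum>j\<in>UNIV. (\<pi> $ j) powr s / B powr (s - 1))"
      using nn by (simp add: inner_vec_def d * del: times_divide_eq_right)
    also have "\<dots> = B powr s / B powr (s - 1)" by (simp add: S flip: sum_divide_distrib)
    also have "\<dots> = B" using B by (simp add: powr_diff)
    finally show ?thesis using A by (simp add: B_def)
  qed
  then show ?A ?B by auto
qed

section \<open>Duality for the second-stage problem\<close>

text \<open>The finite-dimensional Hahn-Banach theorem: the graph point \<open>(h, v h)\<close> is separated from the
  strict epigraph of \<open>v\<close>, which is convex and does not contain it. The hyperplane is not vertical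
  because \<open>v\<close> is finite everywhere.\<close>

lemma sublinear_supporting_functional:
  fixes v :: "'a::euclidean_space \<Rightarrow> real"
  assumes add: "\<And>g h. v (g + h) \<le> v g + v h"
    and scale: "\<And>t h. 0 \<le> t \<Longrightarrow> v (t *\<^sub>R h) = t * v h"
  obtains \<pi> where "\<And>g. \<pi> \<bullet> g \<le> v g" "\<pi> \<bullet> h = v h"
proof -
  let ?E = "{z. v (fst z) < snd z}"
  have "convex ?E"
    unfolding convex_def
  proof (clarify, simp)
    fix g1 s1 g2 s2 and t u :: real
    assume *: "v g1 < s1" "v g2 < s2" "0 \<le> t" "0 \<le> u" "t + u = 1"
    have "v (t *\<^sub>R g1 + u *\<^sub>R g2) \<le> t * v g1 + u * v g2"
      using add[of "t *\<^sub>R g1" "u *\<^sub>R g2"] scale * by simp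
    also have "\<dots> < t * s1 + u * s2"
    proof (cases "t = 0")
      case False
      then show ?thesis using * by (intro add_less_le_mono mult_strict_left_mono mult_left_mono) auto
    qed (use * in auto)
    finally show "v (t *\<^sub>R g1 + u *\<^sub>R g2) < t * s1 + u * s2" .
  qed
  moreover have "?E \<noteq> {}" by (auto intro!: exI[of _ "0"] exI[of _ "v 0 + 1"])
  moreover have "{(h, v h)} \<inter> ?E = {}" by auto
  ultimately obtain ab b0 where ab: "ab \<noteq> 0" "\<forall>z\<in>{(h, v h)}. ab \<bullet> z \<le> b0" "\<forall>z\<in>?E. b0 \<le> ab \<bullet> z"
    using separating_hyperplane_sets[of "{(h, v h)}" ?E] by auto
  obtain a b where [simp]: "ab = (a, b)" by (cases ab)
  have sep: "a \<bullet> h + b * v h \<le> a \<bullet> g + b * s" if "v g < s" for g s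
  proof -
    have "(g, s) \<in> ?E" using that by simp
    then have "b0 \<le> ab \<bullet> (g, s)" using ab(3) by blast
    then show ?thesis using ab(2) by simp
  qed
  have "b \<ge> 0" using sep[of h "v h + 1"] by (simp add: algebra_simps)
  moreover have "b \<noteq> 0"
  proof
    assume "b = 0"
    then have "a \<bullet> a \<le> 0" using sep[of "h - a" "v (h - a) + 1"] by (simp add: inner_diff_right)
    then have "a = 0" by (metis inner_eq_zero_iff inner_ge_zero order_antisym)
    then show False using ab(1) \<open>b = 0\<close> by (simp add: zero_prod_def)
  qed
  ultimately have b: "0 < b" by simp
  have le: "a \<bullet> h + b * v h \<le> a \<bullet> g + b * v g" for g
  proof (rule field_le_epsilon)
    fix e :: real assume "0 < e"
    then have "a \<bullet> h + b * v h \<le> a \<bullet> g + b * (v g + e / b)" using b by (intro sep) simp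
    then show "a \<bullet> h + b * v h \<le> a \<bullet> g + b * v g + e" using b by (simp add: algebra_simps)
  qed
  \<comment> \<open>By homogeneity the supporting hyperplane passes through the origin: compare with \<open>0\<close> and \<open>2 h\<close>.\<close>
  have v0: "v 0 = 0" using scale[of 0 0] by simp
  have eq: "a \<bullet> h + b * v h = 0"
    using le[of 0] le[of "2 *\<^sub>R h"] scale[of 2 h] v0 by simp
  show ?thesis
  proof (rule that[of "- (1 / b) *\<^sub>R a"])
    show "(- (1 / b) *\<^sub>R a) \<bullet> g \<le> v g" for g using le[of g] eq b by (simp add: field_simps)
    show "(- (1 / b) *\<^sub>R a) \<bullet> h = v h" using eq b by (simp add: field_simps)
  qed
qed

lemma convex_cone_product_of_proper_cones:
  fixes K :: "(real ^ 'n) set"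
  assumes "product_of_proper_cones K"
  shows "convex_cone K"
proof -
  obtain P C where C: "\<And>B. B \<in> P \<Longrightarrow> convex_cone (C B)"
    and K: "K = {y. \<forall>B\<in>P. coord_proj B y \<in> C B}"
    using assms by (auto simp: product_of_proper_cones_def proper_cone_in_def)
  have "coord_proj B 0 = 0" "coord_proj B (y + z) = coord_proj B y + coord_proj B z"
    "coord_proj B (t *\<^sub>R y) = t *\<^sub>R coord_proj B y" for B :: "'n set" and y z t
    by (auto simp: coord_proj_def vec_eq_iff)
  then show ?thesis
    using C by (auto simp: K convex_cone_iff)
qed

lemma dual_feasible_iff:
  "\<pi> \<in> dual_feasible c W K \<longleftrightarrow> 0 \<le> \<pi> \<and> (\<forall>y\<in>K. \<pi> \<bullet> (W *v y) \<le> c \<bullet> y)"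
  by (auto simp: dual_feasible_def cone_le_def dual_cone_def inner_diff_left
      transpose_matrix_vector dot_lmul_matrix)

lemma inner_mono_nonneg:
  fixes \<pi> g h :: "real ^ 'k"
  assumes "0 \<le> \<pi>" "g \<le> h"
  shows "\<pi> \<bullet> g \<le> \<pi> \<bullet> h"
  using assms by (auto simp: inner_vec_def less_eq_vec_def intro!: sum_mono mult_left_mono)

lemma dual_feasible_weak_duality:
  assumes "\<pi> \<in> dual_feasible c W K" "y \<in> K" "h \<le> W *v y"
  shows "\<pi> \<bullet> h \<le> c \<bullet> y"
  using assms inner_mono_nonneg[of \<pi> h "W *v y"] by (fastforce simp: dual_feasible_iff)

text \<open>Complete recourse applied to the all-ones right-hand side gives a \<open>y\<close> whose cost bounds the sum of
  the coordinates of every dual feasible vector.\<close>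

lemma compact_dual_feasible:
  fixes W :: "real ^ 'ny ^ 'k"
  assumes "complete_recourse W K"
  shows "compact (dual_feasible c W K)"
proof -
  have "dual_feasible c W K = {\<pi>. \<forall>j. 0 \<le> \<pi> $ j} \<inter> (\<Inter>y\<in>K. {\<pi>. \<pi> \<bullet> (W *v y) \<le> c \<bullet> y})"
    by (auto simp: dual_feasible_iff less_eq_vec_def)
  moreover have "closed {\<pi> :: real ^ 'k. \<forall>j. 0 \<le> \<pi> $ j}"
    by (intro closed_Collect_all closed_Collect_le continuous_intros)
  moreover have "closed (\<Inter>y\<in>K. {\<pi>. \<pi> \<bullet> (W *v y) \<le> c \<bullet> y})"
    by (intro closed_INT ballI closed_Collect_le continuous_intros)
  ultimately have "closed (dual_feasible c W K)" by (simp add: closed_Int)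
  moreover obtain y where y: "y \<in> K" "(\<chi> j. 1) \<le> W *v y"
    using assms unfolding complete_recourse_def by blast
  have "norm \<pi> \<le> c \<bullet> y" if "\<pi> \<in> dual_feasible c W K" for \<pi>
  proof -
    have "0 \<le> \<pi> $ j" for j using that by (simp add: dual_feasible_iff less_eq_vec_def)
    then have "norm \<pi> \<le> \<pi> \<bullet> (\<chi> j. 1)"
      using norm_le_l1_cart[of \<pi>] by (simp add: inner_vec_def)
    also have "\<dots> \<le> c \<bullet> y" using dual_feasible_weak_duality[OF that y] .
    finally show ?thesis .
  qed
  then have "bounded (dual_feasible c W K)" by (auto simp: bounded_iff)
  ultimately show ?thesis by (simp add: compact_eq_bounded_closed)
qed

text \<open>As a function of the right-hand side, the optimal value is finite (by recourse and weak duality) and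
  sublinear (because \<open>K\<close> is a convex cone), so it has a supporting linear functional \<open>\<pi>\<close>. Being dominated
  by the value function is the same as dual feasibility: the right-hand sides \<open>- axis j 1\<close> give
  \<open>0 \<le> \<pi>\<close>, and the right-hand sides \<open>W *v y\<close> with \<open>y\<close> in \<open>K\<close> give the conic constraint. At the
  right-hand side that it supports, \<open>\<pi>\<close> attains the dual optimum.\<close>

lemma second_stage_strong_duality:
  assumes K: "convex_cone K" and cr: "complete_recourse W K" and ne: "dual_feasible c W K \<noteq> {}"
  shows "\<pi> \<in> dual_feasible c W K \<Longrightarrow> \<pi> \<bullet> (T *v x + \<xi>) \<le> second_stage_cost c W T K x \<xi>"
    and "\<exists>\<pi>\<in>dual_feasible c W K. second_stage_cost c W T K x \<xi> = \<pi> \<bullet> (T *v x + \<xi>)"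
proof -
  define v where "v h = (INF y\<in>{y \<in> K. h \<le> W *v y}. c \<bullet> y)" for h
  have cost: "second_stage_cost c W T K x \<xi> = v (T *v x + \<xi>)"
    by (simp add: second_stage_cost_def v_def)
  have feas: "{y \<in> K. h \<le> W *v y} \<noteq> {}" for h
    using cr by (auto simp: complete_recourse_def)
  have weak: "\<pi> \<bullet> h \<le> v h" if "\<pi> \<in> dual_feasible c W K" for \<pi> h
    unfolding v_def using dual_feasible_weak_duality[OF that] by (intro cINF_greatest feas) auto
  then show "\<pi> \<in> dual_feasible c W K \<Longrightarrow> \<pi> \<bullet> (T *v x + \<xi>) \<le> second_stage_cost c W T K x \<xi>"
    by (simp add: cost)
  obtain \<pi>0 where \<pi>0: "\<pi>0 \<in> dual_feasible c W K" using ne by blast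
  have upper: "v h \<le> c \<bullet> y" if "y \<in> K" "h \<le> W *v y" for h y
    unfolding v_def using that dual_feasible_weak_duality[OF \<pi>0]
    by (intro cINF_lower bdd_belowI2[where m = "\<pi>0 \<bullet> h"]) auto
  have greatest: "a \<le> v h" if "\<And>y. y \<in> K \<Longrightarrow> h \<le> W *v y \<Longrightarrow> a \<le> c \<bullet> y" for a h
    unfolding v_def using that by (intro cINF_greatest feas) auto
  have add: "v (g + h) \<le> v g + v h" for g h
  proof -
    have "v (g + h) - v h \<le> v g"
    proof (rule greatest)
      fix y1 assume y1: "y1 \<in> K" "g \<le> W *v y1"
      have "v (g + h) - c \<bullet> y1 \<le> v h"
      proof (rule greatest)
        fix y2 assume y2: "y2 \<in> K" "h \<le> W *v y2"
        have "y1 + y2 \<in> K" using K y1 y2 by (simp add: convex_cone_add)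
        moreover have "g + h \<le> W *v (y1 + y2)"
          using y1 y2 by (simp add: matrix_vector_right_distrib add_mono)
        ultimately have "v (g + h) \<le> c \<bullet> (y1 + y2)" by (rule upper)
        then show "v (g + h) - c \<bullet> y1 \<le> c \<bullet> y2" by (simp add: inner_add_right)
      qed
      then show "v (g + h) - v h \<le> c \<bullet> y1" by simp
    qed
    then show ?thesis by simp
  qed
  have scale_le: "v (t *\<^sub>R h) \<le> t * v h" if t: "0 < t" for t h
  proof -
    have "v (t *\<^sub>R h) / t \<le> v h"
    proof (rule greatest)
      fix y assume y: "y \<in> K" "h \<le> W *v y"
      have "t *\<^sub>R y \<in> K" using K y t by (simp add: convex_cone_scaleR)
      moreover have "t *\<^sub>R h \<le> W *v (t *\<^sub>R y)"
        using y t by (simp add: matrix_vector_mult_scaleR less_eq_vec_def)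
      ultimately have "v (t *\<^sub>R h) \<le> c \<bullet> (t *\<^sub>R y)" by (rule upper)
      then show "v (t *\<^sub>R h) / t \<le> c \<bullet> y" using t by (simp add: field_simps)
    qed
    then show ?thesis using t by (simp add: field_simps)
  qed
  have v0: "v 0 = 0"
    using weak[OF \<pi>0, of 0] upper[of 0 0] K by (simp add: convex_cone_contains_0)
  have scale: "v (t *\<^sub>R h) = t * v h" if "0 \<le> t" for t h
  proof (cases "t = 0")
    case False
    then have t: "0 < t" using that by simp
    have "v h \<le> (1 / t) * v (t *\<^sub>R h)" using scale_le[of "1 / t" "t *\<^sub>R h"] t by simp
    then show ?thesis using scale_le[OF t, of h] t by (simp add: field_simps)
  qed (simp add: v0)
  obtain \<pi> where \<pi>: "\<And>g. \<pi> \<bullet> g \<le> v g" "\<pi> \<bullet> (T *v x + \<xi>) = v (T *v x + \<xi>)"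
    using sublinear_supporting_functional[of v, OF add scale] by blast
  have "0 \<le> \<pi> $ j" for j
  proof -
    have "v (- axis j 1) \<le> c \<bullet> 0"
      using K by (intro upper) (auto simp: convex_cone_contains_0 less_eq_vec_def axis_def)
    then show ?thesis using \<pi>(1)[of "- axis j 1"] by (simp add: inner_axis)
  qed
  moreover have "\<pi> \<bullet> (W *v y) \<le> c \<bullet> y" if "y \<in> K" for y
    using \<pi>(1)[of "W *v y"] upper[OF that order_refl] by linarith
  ultimately have "\<pi> \<in> dual_feasible c W K"
    by (simp add: dual_feasible_iff less_eq_vec_def)
  then show "\<exists>\<pi>\<in>dual_feasible c W K. second_stage_cost c W T K x \<xi> = \<pi> \<bullet> (T *v x + \<xi>)"
    using \<pi>(2) cost by metis
qed

section \<open>Growth of support functions\<close>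

text \<open>A maximiser at \<open>z\<close> is a subgradient there, and Hoelder's inequality bounds its slope.\<close>

lemma support_function_lipschitz:
  fixes f :: "real ^ 'k \<Rightarrow> real" and S :: "(real ^ 'k) set"
  assumes pq: "1 \<le> p" "1 \<le> q" "1 / p + 1 / q = 1"
    and att: "\<And>\<xi>. \<exists>\<pi>\<in>S. f \<xi> = \<pi> \<bullet> (b + \<xi>)"
    and le: "\<And>\<pi> \<xi>. \<pi> \<in> S \<Longrightarrow> \<pi> \<bullet> (b + \<xi>) \<le> f \<xi>"
    and M: "\<And>\<pi>. \<pi> \<in> S \<Longrightarrow> lp_norm q \<pi> \<le> M"
  shows "f z - f a \<le> M * lp_norm p (z - a)"
proof -
  obtain \<pi> where \<pi>: "\<pi> \<in> S" "f z = \<pi> \<bullet> (b + z)" using att by blast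
  have "f z - f a \<le> \<pi> \<bullet> (z - a)" using \<pi> le[OF \<pi>(1), of a] by (simp add: inner_simps)
  also have "\<dots> \<le> lp_norm p (z - a) * lp_norm q \<pi>"
    using Holder_inequality_lp[OF pq, of "z - a" \<pi>] by (simp add: inner_commute)
  also have "\<dots> \<le> lp_norm p (z - a) * M" using M[OF \<pi>(1)] by (intro mult_left_mono) auto
  finally show ?thesis by (simp add: mult.commute)
qed

text \<open>If no element of \<open>S\<close> has maximal norm and is at the same time optimal at \<open>a\<close>, then an element that is
  optimal at \<open>z\<close> has either too small a norm, which costs an amount proportional to the distance, or
  too small a value at \<open>a\<close>, which costs a constant. The smaller of these two costs is what the term
  \<open>min 1 (lp_norm p (z - a))\<close> records; compactness makes the factor uniform.\<close>

lemma support_function_slack: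
  fixes f :: "real ^ 'k \<Rightarrow> real" and S :: "(real ^ 'k) set"
  assumes pq: "1 \<le> p" "1 \<le> q" "1 / p + 1 / q = 1"
    and cpt: "compact S"
    and att: "\<And>\<xi>. \<exists>\<pi>\<in>S. f \<xi> = \<pi> \<bullet> (b + \<xi>)"
    and le: "\<And>\<pi> \<xi>. \<pi> \<in> S \<Longrightarrow> \<pi> \<bullet> (b + \<xi>) \<le> f \<xi>"
    and M: "\<And>\<pi>. \<pi> \<in> S \<Longrightarrow> lp_norm q \<pi> \<le> M"
    and disj: "\<And>\<pi>. \<pi> \<in> S \<Longrightarrow> \<not> (lp_norm q \<pi> = M \<and> \<pi> \<bullet> (b + a) = f a)"
  obtains s where "0 < s" "\<And>z. f z - f a \<le> M * lp_norm p (z - a) - s * min 1 (lp_norm p (z - a))"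
proof -
  define g where "g \<pi> = (M - lp_norm q \<pi>) + (f a - \<pi> \<bullet> (b + a))" for \<pi>
  have "continuous_on S g" unfolding g_def by (intro continuous_intros pq)
  moreover have "S \<noteq> {}" using att by blast
  ultimately obtain \<pi>0 where \<pi>0: "\<pi>0 \<in> S" "\<And>\<pi>. \<pi> \<in> S \<Longrightarrow> g \<pi>0 \<le> g \<pi>"
    using continuous_attains_inf[OF cpt] by metis
  have pos: "0 < g \<pi>0"
    using M[OF \<pi>0(1)] le[OF \<pi>0(1), of a] disj[OF \<pi>0(1)] unfolding g_def by linarith
  show ?thesis
  proof (rule that[OF pos])
    fix z
    define D where "D = lp_norm p (z - a)"
    have D: "0 \<le> D" by (simp add: D_def)
    obtain \<pi> where \<pi>: "\<pi> \<in> S" "f z = \<pi> \<bullet> (b + z)" using att by blast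
    have hol: "\<pi> \<bullet> (z - a) \<le> D * lp_norm q \<pi>"
      using Holder_inequality_lp[OF pq, of "z - a" \<pi>] by (simp add: inner_commute D_def)
    have nn: "0 \<le> M - lp_norm q \<pi>" "0 \<le> f a - \<pi> \<bullet> (b + a)"
      using M[OF \<pi>(1)] le[OF \<pi>(1), of a] by auto
    have "g \<pi>0 * min 1 D \<le> g \<pi> * min 1 D" using \<pi>0(2)[OF \<pi>(1)] D by (intro mult_right_mono) auto
    also have "\<dots> = (M - lp_norm q \<pi>) * min 1 D + (f a - \<pi> \<bullet> (b + a)) * min 1 D"
      by (simp add: g_def distrib_right)
    also have "\<dots> \<le> (M - lp_norm q \<pi>) * D + (f a - \<pi> \<bullet> (b + a)) * 1"
      using nn by (intro add_mono mult_left_mono) auto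
    also have "\<dots> \<le> M * D - (f z - f a)"
      using hol \<pi>(2) by (simp add: algebra_simps inner_simps)
    finally show "f z - f a \<le> M * lp_norm p (z - a) - g \<pi>0 * min 1 (lp_norm p (z - a))"
      by (simp add: D_def)
  qed
qed

section \<open>Finite mixtures of Dirac measures\<close>

lemma sets_dirac_mixture [simp, measurable_cong]:
  "sets (dirac_mixture \<Xi> I w z) = sets (borel_on \<Xi>)"
  by (simp add: dirac_mixture_def)

lemma space_dirac_mixture [simp]: "space (dirac_mixture \<Xi> I w z) = \<Xi>"
  by (simp add: dirac_mixture_def space_restrict_space)

lemma measurable_point_measure_borel_on:
  assumes "\<And>i. i \<in> I \<Longrightarrow> z i \<in> \<Xi>"
  shows "z \<in> point_measure I w \<rightarrow>\<^sub>M borel_on \<Xi>"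
  using assms by (auto simp: space_restrict_space)

lemma prob_space_dirac_mixture:
  assumes "finite I" "\<And>i. i \<in> I \<Longrightarrow> z i \<in> \<Xi>" "\<And>i. i \<in> I \<Longrightarrow> 0 \<le> w i" "sum w I = 1"
  shows "prob_space (dirac_mixture \<Xi> I w z)"
proof -
  interpret prob_space "point_measure I (\<lambda>i. ennreal (w i))"
    using assms by (intro prob_space_point_measure) auto
  show ?thesis
    unfolding dirac_mixture_def
    by (intro prob_space_distr measurable_point_measure_borel_on assms)
qed

lemma integral_dirac_mixture:
  fixes f :: "real ^ 'k \<Rightarrow> real"
  assumes "finite I" "\<And>i. i \<in> I \<Longrightarrow> z i \<in> \<Xi>" "\<And>i. i \<in> I \<Longrightarrow> 0 \<le> w i"
    and f: "f \<in> borel_measurable borel"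
  shows "(\<integral>\<xi>. f \<xi> \<partial>dirac_mixture \<Xi> I w z) = (\<Sum>i\<in>I. w i * f (z i))"
proof -
  have "(\<integral>\<xi>. f \<xi> \<partial>dirac_mixture \<Xi> I w z) = (\<integral>i. f (z i) \<partial>point_measure I (\<lambda>i. ennreal (w i)))"
    unfolding dirac_mixture_def
    by (intro integral_distr measurable_point_measure_borel_on measurable_restrict_space1 assms)
  then show ?thesis using assms by (simp add: lebesgue_integral_point_measure_finite)
qed

lemma borel_measurable_lp_norm [measurable]:
  assumes "1 \<le> p"
  shows "lp_norm p \<in> borel_measurable borel"
  using continuous_on_lp_norm[OF assms continuous_on_id, of UNIV]
  by (intro borel_measurable_continuous_onI) simp

lemma dirac_mixture_prob_with_moment:
  assumes "finite I" "\<And>i. i \<in> I \<Longrightarrow> z i \<in> \<Xi>" "\<And>i. i \<in> I \<Longrightarrow> 0 \<le> w i" "sum w I = 1"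
    and "1 \<le> p"
  shows "dirac_mixture \<Xi> I w z \<in> prob_with_moment p r \<Xi>"
proof -
  have "(\<integral>\<^sup>+ \<xi>. ennreal (lp_norm p \<xi> powr r) \<partial>dirac_mixture \<Xi> I w z)
      = (\<Sum>i\<in>I. ennreal (w i) * ennreal (lp_norm p (z i) powr r))"
    unfolding dirac_mixture_def using assms
    by (subst nn_integral_distr[OF measurable_point_measure_borel_on])
      (auto intro!: measurable_restrict_space1 simp: nn_integral_point_measure_finite)
  also have "\<dots> < \<infinity>" using assms(1) by (simp add: ennreal_mult_less_top)
  finally show ?thesis
    using prob_space_dirac_mixture[OF assms(1-4)] by (simp add: prob_with_moment_def)
qed

section \<open>Couplings and the Wasserstein distance of order 1\<close>

lemma ennreal_powr_1 [simp]: "ennreal_powr t 1 = t"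
  by (cases t) (auto simp: ennreal_powr_def)

lemma wasserstein_1:
  "wasserstein p 1 Q1 Q2 =
     (INF \<gamma>\<in>couplings Q1 Q2. \<integral>\<^sup>+ z. ennreal (lp_norm p (fst z - snd z)) \<partial>\<gamma>)"
  by (simp add: wasserstein_def)

lemma measurable_transport_cost:
  assumes "1 \<le> p"
  shows "(\<lambda>z. lp_norm p (fst z - snd z))
    \<in> borel_measurable (borel_on \<Xi> \<Otimes>\<^sub>M borel_on \<Xi>')"
proof -
  have "fst \<in> borel_on \<Xi> \<Otimes>\<^sub>M borel_on \<Xi>' \<rightarrow>\<^sub>M borel"
    by (rule measurable_compose[OF measurable_fst])
      (simp add: measurable_restrict_space1)
  moreover have "snd \<in> borel_on \<Xi> \<Otimes>\<^sub>M borel_on \<Xi>' \<rightarrow>\<^sub>M borel"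
    by (rule measurable_compose[OF measurable_snd])
      (simp add: measurable_restrict_space1)
  ultimately show ?thesis
    by (intro measurable_compose[OF borel_measurable_diff borel_measurable_lp_norm[OF assms]])
qed

text \<open>Moving each atom \<open>z i\<close> to \<open>z' i\<close> with its whole mass is a coupling: the pushforward of the
  weights along \<open>\<lambda>i. (z i, z' i)\<close>.\<close>

lemma wasserstein_dirac_mixture_le:
  assumes I: "finite I" and z: "\<And>i. i \<in> I \<Longrightarrow> z i \<in> \<Xi>" "\<And>i. i \<in> I \<Longrightarrow> z' i \<in> \<Xi>"
    and w: "\<And>i. i \<in> I \<Longrightarrow> 0 \<le> w i" "sum w I = 1" and p: "1 \<le> p"
  shows "wasserstein p 1 (dirac_mixture \<Xi> I w z) (dirac_mixture \<Xi> I w z')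
    \<le> ennreal (\<Sum>i\<in>I. w i * lp_norm p (z i - z' i))"
proof -
  let ?Q = "dirac_mixture \<Xi> I w z" and ?Q' = "dirac_mixture \<Xi> I w z'"
  let ?P = "point_measure I (\<lambda>i. ennreal (w i))"
  interpret prob_space ?P using assms by (intro prob_space_point_measure) auto
  define \<gamma> where "\<gamma> = distr ?P (?Q \<Otimes>\<^sub>M ?Q') (\<lambda>i. (z i, z' i))"
  have m: "(\<lambda>i. (z i, z' i)) \<in> ?P \<rightarrow>\<^sub>M ?Q \<Otimes>\<^sub>M ?Q'"
    using z by (auto simp: space_pair_measure)
  have "distr \<gamma> ?Q fst = distr ?P ?Q z"
    unfolding \<gamma>_def by (subst distr_distr[OF _ m]) (auto simp: comp_def)
  also have "\<dots> = ?Q" unfolding dirac_mixture_def by (intro distr_cong) auto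
  finally have fst: "distr \<gamma> ?Q fst = ?Q" .
  have "distr \<gamma> ?Q' snd = distr ?P ?Q' z'"
    unfolding \<gamma>_def by (subst distr_distr[OF _ m]) (auto simp: comp_def)
  also have "\<dots> = ?Q'" unfolding dirac_mixture_def by (intro distr_cong) auto
  finally have \<gamma>: "\<gamma> \<in> couplings ?Q ?Q'"
    using fst prob_space_distr[OF m] by (simp add: couplings_def \<gamma>_def)
  have "sets (?Q \<Otimes>\<^sub>M ?Q') = sets (borel_on \<Xi> \<Otimes>\<^sub>M borel_on \<Xi>)"
    by (intro sets_pair_measure_cong) auto
  then have mm: "(\<lambda>z. ennreal (lp_norm p (fst z - snd z))) \<in> borel_measurable (?Q \<Otimes>\<^sub>M ?Q')"
    using measurable_transport_cost[OF p] by (subst measurable_cong_sets) auto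
  have "wasserstein p 1 ?Q ?Q' \<le> (\<integral>\<^sup>+ z. ennreal (lp_norm p (fst z - snd z)) \<partial>\<gamma>)"
    unfolding wasserstein_1 using \<gamma> by (rule INF_lower)
  also have "\<dots> = (\<integral>\<^sup>+ i. ennreal (lp_norm p (z i - z' i)) \<partial>?P)"
    unfolding \<gamma>_def using mm by (subst nn_integral_distr[OF m]) auto
  also have "\<dots> = ennreal (\<Sum>i\<in>I. w i * lp_norm p (z i - z' i))"
    using I w by (simp add: nn_integral_point_measure_finite ennreal_mult mult_nonneg_nonneg
        flip: sum_ennreal)
  finally show ?thesis .
qed

lemma wasserstein_1_near_optimal_coupling:
  assumes p: "1 \<le> p" and sets: "sets Q = sets (borel_on \<Xi>)" "sets P = sets (borel_on \<Xi>')"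
    and W: "wasserstein p 1 Q P \<le> ennreal \<epsilon>" and "0 \<le> \<epsilon>" "0 < \<delta>"
  obtains \<gamma> where "\<gamma> \<in> couplings Q P"
    "integrable \<gamma> (\<lambda>z. lp_norm p (fst z - snd z))"
    "(\<integral>z. lp_norm p (fst z - snd z) \<partial>\<gamma>) \<le> \<epsilon> + \<delta>"
proof -
  have "wasserstein p 1 Q P < ennreal (\<epsilon> + \<delta>)"
    using W assms by (metis add_strict_increasing2 ennreal_less_iff le_less_trans less_add_same_cancel1)
  then obtain \<gamma> where \<gamma>: "\<gamma> \<in> couplings Q P"
    and less: "(\<integral>\<^sup>+ z. ennreal (lp_norm p (fst z - snd z)) \<partial>\<gamma>) < ennreal (\<epsilon> + \<delta>)"
    unfolding wasserstein_1 INF_less_iff by blast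
  have "sets \<gamma> = sets (borel_on \<Xi> \<Otimes>\<^sub>M borel_on \<Xi>')"
    using \<gamma> sets by (auto simp: couplings_def cong: sets_pair_measure_cong)
  then have m: "(\<lambda>z. lp_norm p (fst z - snd z)) \<in> borel_measurable \<gamma>"
    using measurable_transport_cost[OF p] by (subst measurable_cong_sets) auto
  have int: "integrable \<gamma> (\<lambda>z. lp_norm p (fst z - snd z))"
    using less m by (intro integrableI_nonneg) (auto simp: less_top[symmetric] intro: less_trans)
  moreover have "(\<integral>z. lp_norm p (fst z - snd z) \<partial>\<gamma>) \<le> \<epsilon> + \<delta>"
  proof -
    have "ennreal (\<integral>z. lp_norm p (fst z - snd z) \<partial>\<gamma>) < ennreal (\<epsilon> + \<delta>)"
      using less nn_integral_eq_integral[OF int] by (simp del: ennreal_plus)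
    then show ?thesis by (simp add: ennreal_less_iff integral_nonneg_AE del: ennreal_plus)
  qed
  ultimately show ?thesis using \<gamma> that by blast
qed

text \<open>Integrals of functions of one coordinate are determined by the marginals.\<close>

lemma
  fixes f :: "'a \<Rightarrow> real" and g :: "'b \<Rightarrow> real"
  assumes \<gamma>: "\<gamma> \<in> couplings Q P"
  shows measurable_coupling_fst: "fst \<in> \<gamma> \<rightarrow>\<^sub>M Q" and measurable_coupling_snd: "snd \<in> \<gamma> \<rightarrow>\<^sub>M P"
    and integrable_coupling_fst: "integrable Q f \<Longrightarrow> integrable \<gamma> (\<lambda>z. f (fst z))"
    and integrable_coupling_snd: "integrable P g \<Longrightarrow> integrable \<gamma> (\<lambda>z. g (snd z))"
    and integral_coupling_fst: "integrable Q f \<Longrightarrow> (\<integral>z. f (fst z) \<partial>\<gamma>) = (\<integral>\<xi>. f \<xi> \<partial>Q)"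
    and integral_coupling_snd: "integrable P g \<Longrightarrow> (\<integral>z. g (snd z) \<partial>\<gamma>) = (\<integral>\<xi>. g \<xi> \<partial>P)"
proof -
  have d: "distr \<gamma> Q fst = Q" "distr \<gamma> P snd = P" and s: "sets \<gamma> = sets (Q \<Otimes>\<^sub>M P)"
    using \<gamma> by (auto simp: couplings_def)
  show 1: "fst \<in> \<gamma> \<rightarrow>\<^sub>M Q" by (simp add: measurable_cong_sets[OF s refl])
  show 2: "snd \<in> \<gamma> \<rightarrow>\<^sub>M P" by (simp add: measurable_cong_sets[OF s refl])
  show "integrable \<gamma> (\<lambda>z. f (fst z))" if "integrable Q f"
    using integrable_distr[OF 1, of f] that d by simp
  show "integrable \<gamma> (\<lambda>z. g (snd z))" if "integrable P g"
    using integrable_distr[OF 2, of g] that d by simp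
  show "(\<integral>z. f (fst z) \<partial>\<gamma>) = (\<integral>\<xi>. f \<xi> \<partial>Q)" if "integrable Q f"
    using integral_distr[OF 1, of f] that d by (simp add: borel_measurable_integrable)
  show "(\<integral>z. g (snd z) \<partial>\<gamma>) = (\<integral>\<xi>. g \<xi> \<partial>P)" if "integrable P g"
    using integral_distr[OF 2, of g] that d by (simp add: borel_measurable_integrable)
qed

section \<open>Upper bounds for the worst-case expectation\<close>

lemma continuous_on_lp_lipschitz:
  fixes f :: "real ^ 'k \<Rightarrow> real"
  assumes p: "1 \<le> p" and M: "0 \<le> M" and L: "\<And>z a. f z - f a \<le> M * lp_norm p (z - a)"
  shows "continuous_on UNIV f"
proof (rule lipschitz_on_continuous_on)
  have "f z - f a \<le> M * real CARD('k) * dist z a" for z a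
  proof -
    have "lp_norm p (z - a) \<le> real CARD('k) * norm (z - a)"
      using lp_norm_le_infnorm[OF p, of "z - a"] infnorm_le_norm[of "z - a"]
      by (meson mult_left_mono of_nat_0_le_iff order_trans)
    then have "M * lp_norm p (z - a) \<le> M * (real CARD('k) * norm (z - a))"
      using M by (rule mult_left_mono)
    then show ?thesis using L[of z a] by (simp add: dist_norm mult.assoc)
  qed
  note * = this
  show "(M * real CARD('k))-lipschitz_on UNIV f"
  proof (rule lipschitz_onI)
    show "dist (f x) (f y) \<le> M * real CARD('k) * dist x y" for x y
      using *[of x y] *[of y x] by (simp add: dist_real_def abs_le_iff dist_commute)
  qed (use M in simp)
qed

lemma prob_with_moment_borel_measurable:
  fixes f :: "real ^ 'k \<Rightarrow> real"
  assumes "Q \<in> prob_with_moment p r \<Xi>" "f \<in> borel_measurable borel"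
  shows "f \<in> borel_measurable Q"
proof -
  have "sets Q = sets (borel_on \<Xi>)" using assms(1) by (simp add: prob_with_moment_def)
  then show ?thesis
    using measurable_restrict_space1[OF assms(2), of \<Xi>]
      measurable_cong_sets[of Q "borel_on \<Xi>" borel borel] by simp
qed

lemma prob_with_moment_integrable_lp_norm:
  assumes "Q \<in> prob_with_moment p 1 \<Xi>" "1 \<le> p"
  shows "integrable Q (lp_norm p)"
proof (rule integrableI_nonneg)
  show "lp_norm p \<in> borel_measurable Q"
    by (rule prob_with_moment_borel_measurable[OF assms(1) borel_measurable_lp_norm[OF assms(2)]])
  show "(\<integral>\<^sup>+ \<xi>. ennreal (lp_norm p \<xi>) \<partial>Q) < \<infinity>"
    using assms by (simp add: prob_with_moment_def)
qed simp

lemma prob_with_moment_integrable_lipschitz: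
  fixes f :: "real ^ 'k \<Rightarrow> real"
  assumes Q: "Q \<in> prob_with_moment p 1 \<Xi>" and p: "1 \<le> p"
    and M: "0 \<le> M" and L: "\<And>z a. f z - f a \<le> M * lp_norm p (z - a)"
  shows "integrable Q f"
proof -
  interpret prob_space Q using Q by (simp add: prob_with_moment_def)
  have "f \<in> borel_measurable Q"
    using continuous_on_lp_lipschitz[OF p M L]
    by (intro prob_with_moment_borel_measurable[OF Q] borel_measurable_continuous_onI)
  moreover have "integrable Q (\<lambda>\<xi>. \<bar>f 0\<bar> + M * lp_norm p \<xi>)"
    using prob_with_moment_integrable_lp_norm[OF Q p] by simp
  moreover have "norm (f \<xi>) \<le> norm (\<bar>f 0\<bar> + M * lp_norm p \<xi>)" for \<xi>
  proof -
    have "\<bar>f \<xi>\<bar> \<le> \<bar>f 0\<bar> + M * lp_norm p \<xi>" using L[of \<xi> 0] L[of 0 \<xi>] by simp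
    then show ?thesis by simp
  qed
  ultimately show ?thesis by (intro Bochner_Integration.integrable_bound[of Q _ f]) auto
qed

text \<open>The easy half of Kantorovich-Rubinstein duality. The Lipschitz inequality is integrated
  against a coupling of cost at most \<open>\<epsilon> + \<delta>\<close>, and then \<open>\<delta>\<close> tends to \<open>0\<close>.\<close>

lemma kantorovich_upper_bound:
  fixes f :: "real ^ 'k \<Rightarrow> real"
  assumes p: "1 \<le> p" and M: "0 \<le> M" and L: "\<And>z a. f z - f a \<le> M * lp_norm p (z - a)"
    and Q: "Q \<in> prob_with_moment p 1 \<Xi>" and P: "P \<in> prob_with_moment p 1 \<Xi>"
    and W: "wasserstein p 1 Q P \<le> ennreal \<epsilon>" and \<epsilon>: "0 \<le> \<epsilon>"
  shows "(\<integral>\<xi>. f \<xi> \<partial>Q) \<le> (\<integral>\<xi>. f \<xi> \<partial>P) + M * \<epsilon>"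
proof (rule field_le_epsilon)
  fix e :: real assume e: "0 < e"
  \<comment> \<open>The summand \<open>1\<close> covers the case \<open>M = 0\<close>.\<close>
  define \<delta> where "\<delta> = e / (M + 1)"
  have \<delta>: "0 < \<delta>" "M * \<delta> \<le> e" using e M by (auto simp: \<delta>_def field_simps)
  obtain \<gamma> where \<gamma>: "\<gamma> \<in> couplings Q P" "integrable \<gamma> (\<lambda>z. lp_norm p (fst z - snd z))"
    "(\<integral>z. lp_norm p (fst z - snd z) \<partial>\<gamma>) \<le> \<epsilon> + \<delta>"
    using wasserstein_1_near_optimal_coupling[OF p _ _ W \<epsilon> \<delta>(1)] P Q
    by (auto simp: prob_with_moment_def)
  note int = prob_with_moment_integrable_lipschitz[OF Q p M L]
    prob_with_moment_integrable_lipschitz[OF P p M L]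
  note cint = integrable_coupling_fst[OF \<gamma>(1) int(1)] integrable_coupling_snd[OF \<gamma>(1) int(2)]
  have "(\<integral>\<xi>. f \<xi> \<partial>Q) - (\<integral>\<xi>. f \<xi> \<partial>P) = (\<integral>z. f (fst z) - f (snd z) \<partial>\<gamma>)"
    using cint integral_coupling_fst[OF \<gamma>(1) int(1)] integral_coupling_snd[OF \<gamma>(1) int(2)] by simp
  also have "\<dots> \<le> (\<integral>z. M * lp_norm p (fst z - snd z) \<partial>\<gamma>)"
    using cint \<gamma>(2) L by (intro integral_mono) auto
  also have "\<dots> \<le> M * (\<epsilon> + \<delta>)" using \<gamma>(3) M by (simp add: mult_left_mono)
  finally show "(\<integral>\<xi>. f \<xi> \<partial>Q) \<le> (\<integral>\<xi>. f \<xi> \<partial>P) + M * \<epsilon> + e"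
    using \<delta>(2) by (simp add: algebra_simps)
qed

lemma integrable_tail_small:
  fixes g :: "'a \<Rightarrow> real"
  assumes g: "integrable Q g" and e: "0 < e"
  obtains R where "1 \<le> R" "(\<integral>\<xi>. (if R < g \<xi> then g \<xi> else 0) \<partial>Q) < e"
proof -
  have [measurable]: "g \<in> borel_measurable Q" using g by simp
  have "(\<lambda>n. \<integral>\<xi>. (if real n < g \<xi> then g \<xi> else 0) \<partial>Q) \<longlonglongrightarrow> (\<integral>\<xi>. 0 \<partial>Q)"
  proof (rule integral_dominated_convergence[where w = "\<lambda>\<xi>. \<bar>g \<xi>\<bar>"])
    show "AE \<xi> in Q. (\<lambda>n. if real n < g \<xi> then g \<xi> else 0) \<longlonglongrightarrow> 0"
    proof (rule AE_I2)
      fix \<xi>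
      have "\<forall>\<^sub>F n in sequentially. g \<xi> \<le> real n"
        using eventually_ge_at_top[of "nat \<lceil>g \<xi>\<rceil>"] by eventually_elim linarith
      then have "\<forall>\<^sub>F n in sequentially. (if real n < g \<xi> then g \<xi> else 0) = 0"
        by eventually_elim simp
      then show "(\<lambda>n. if real n < g \<xi> then g \<xi> else 0) \<longlonglongrightarrow> 0" by (rule tendsto_eventually)
    qed
  qed (use g in auto)
  then have "\<forall>\<^sub>F n in sequentially. (\<integral>\<xi>. (if real n < g \<xi> then g \<xi> else 0) \<partial>Q) < e"
    using e by (auto dest: order_tendstoD(2)[where a = e])
  then obtain m where "\<And>n. m \<le> n \<Longrightarrow> (\<integral>\<xi>. (if real n < g \<xi> then g \<xi> else 0) \<partial>Q) < e"
    by (auto simp: eventually_sequentially)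
  then show ?thesis using that[of "real (max 1 m)"] by simp
qed

text \<open>The improved Lipschitz inequality at the support of \<open>P\<close> makes the bound of
  \<open>kantorovich_upper_bound\<close> strict. If equality held, a coupling of cost at most \<open>\<epsilon> + \<delta>\<close> would have
  truncated cost \<open>\<integral> min 1 D\<close> at most \<open>M * \<delta> / s\<close>. As \<open>A\<close> is bounded, the cost \<open>D\<close> is dominated by a
  \<open>Q\<close>-integrable function \<open>g\<close> of the first coordinate, so
  \<open>D \<le> R * min 1 D + (if R < g then g else 0)\<close>, where the last term has an integral that does not depend on
  the coupling and is small for large \<open>R\<close>. Choosing first \<open>R\<close> and then \<open>\<delta>\<close> makes the cost less than
  \<open>\<epsilon>\<close>, too small for the assumed difference of the integrals.\<close>

lemma kantorovich_bound_strict: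
  fixes f :: "real ^ 'k \<Rightarrow> real"
  assumes p: "1 \<le> p" and M: "0 < M" and L: "\<And>z a. f z - f a \<le> M * lp_norm p (z - a)"
    and A: "finite A" "AE a in P. a \<in> A"
    and s: "0 < s"
      "\<And>z a. a \<in> A \<Longrightarrow> f z - f a \<le> M * lp_norm p (z - a) - s * min 1 (lp_norm p (z - a))"
    and Q: "Q \<in> prob_with_moment p 1 \<Xi>" and P: "P \<in> prob_with_moment p 1 \<Xi>"
    and W: "wasserstein p 1 Q P \<le> ennreal \<epsilon>" and \<epsilon>: "0 < \<epsilon>"
  shows "(\<integral>\<xi>. f \<xi> \<partial>Q) < (\<integral>\<xi>. f \<xi> \<partial>P) + M * \<epsilon>"
proof (rule ccontr)
  assume "\<not> ?thesis"
  then have large: "M * \<epsilon> \<le> (\<integral>\<xi>. f \<xi> \<partial>Q) - (\<integral>\<xi>. f \<xi> \<partial>P)" by simp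
  interpret Q: prob_space Q using Q by (simp add: prob_with_moment_def)
  define b where "b = (\<Sum>a\<in>A. infnorm a)"
  have b: "infnorm a \<le> b" if "a \<in> A" for a
    unfolding b_def using A that by (intro member_le_sum) (auto simp: infnorm_pos_le)
  define g where "g \<xi> = real CARD('k) * (lp_norm p \<xi> + b)" for \<xi> :: "real ^ 'k"
  have g: "integrable Q g"
    unfolding g_def using prob_with_moment_integrable_lp_norm[OF Q p] by simp
  have dist_le: "lp_norm p (z - a) \<le> g z" if "a \<in> A" for z a
  proof -
    have "infnorm (z - a) \<le> infnorm z + infnorm a"
      using infnorm_triangle[of z "- a"] by (simp add: infnorm_neg)
    also have "\<dots> \<le> lp_norm p z + b" using infnorm_le_lp_norm[OF p, of z] b[OF that] by simp
    finally show ?thesis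
      unfolding g_def using lp_norm_le_infnorm[OF p, of "z - a"]
      by (meson mult_left_mono of_nat_0_le_iff order_trans)
  qed
  obtain R where R: "1 \<le> R" "(\<integral>\<xi>. (if R < g \<xi> then g \<xi> else 0) \<partial>Q) < \<epsilon> / 2"
    using integrable_tail_small[OF g, of "\<epsilon> / 2"] \<epsilon> by auto
  \<comment> \<open>Chosen such that \<open>R * (M * \<delta> / s) = \<epsilon> / 2\<close>.\<close>
  define \<delta> where "\<delta> = s * \<epsilon> / (2 * R * M)"
  have \<delta>: "0 < \<delta>" using s \<epsilon> R M by (simp add: \<delta>_def)
  obtain \<gamma> where \<gamma>: "\<gamma> \<in> couplings Q P" "integrable \<gamma> (\<lambda>z. lp_norm p (fst z - snd z))"
    "(\<integral>z. lp_norm p (fst z - snd z) \<partial>\<gamma>) \<le> \<epsilon> + \<delta>"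
    using wasserstein_1_near_optimal_coupling[OF p _ _ W less_imp_le[OF \<epsilon>] \<delta>] P Q
    by (auto simp: prob_with_moment_def)
  interpret \<gamma>: prob_space \<gamma> using \<gamma>(1) by (simp add: couplings_def)
  define D where "D z = lp_norm p (fst z - snd z)" for z :: "(real ^ 'k) \<times> (real ^ 'k)"
  have D: "integrable \<gamma> D" "(\<integral>z. D z \<partial>\<gamma>) \<le> \<epsilon> + \<delta>" using \<gamma> by (simp_all add: D_def[abs_def])
  then have [measurable]: "D \<in> borel_measurable \<gamma>" by simp
  have D0: "0 \<le> D z" for z by (simp add: D_def)
  have D1: "integrable \<gamma> (\<lambda>z. min 1 (D z))"
    using D(1) by (rule Bochner_Integration.integrable_bound) (auto simp: D0)
  have AE: "AE z in \<gamma>. snd z \<in> A"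
  proof -
    have "distr \<gamma> P snd = P" using \<gamma>(1) by (simp add: couplings_def)
    then show ?thesis
      using AE_distrD[OF measurable_coupling_snd[OF \<gamma>(1)], of "\<lambda>a. a \<in> A"] A(2) by metis
  qed
  note int = prob_with_moment_integrable_lipschitz[OF Q p less_imp_le[OF M] L]
    prob_with_moment_integrable_lipschitz[OF P p less_imp_le[OF M] L]
  note cint = integrable_coupling_fst[OF \<gamma>(1) int(1)] integrable_coupling_snd[OF \<gamma>(1) int(2)]
  have "(\<integral>\<xi>. f \<xi> \<partial>Q) - (\<integral>\<xi>. f \<xi> \<partial>P) = (\<integral>z. f (fst z) - f (snd z) \<partial>\<gamma>)"
    using cint integral_coupling_fst[OF \<gamma>(1) int(1)] integral_coupling_snd[OF \<gamma>(1) int(2)] by simp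
  also have "\<dots> \<le> (\<integral>z. M * D z - s * min 1 (D z) \<partial>\<gamma>)"
  proof (intro integral_mono_AE)
    show "AE z in \<gamma>. f (fst z) - f (snd z) \<le> M * D z - s * min 1 (D z)"
      using AE by eventually_elim (simp add: s(2) D_def)
  qed (use cint D D1 in auto)
  also have "\<dots> = M * (\<integral>z. D z \<partial>\<gamma>) - s * (\<integral>z. min 1 (D z) \<partial>\<gamma>)"
    using D D1 by simp
  finally have gap: "M * \<epsilon> \<le> M * (\<integral>z. D z \<partial>\<gamma>) - s * (\<integral>z. min 1 (D z) \<partial>\<gamma>)"
    using large by simp
  have "M * (\<integral>z. D z \<partial>\<gamma>) \<le> M * (\<epsilon> + \<delta>)" using D M by simp
  with gap have "s * (\<integral>z. min 1 (D z) \<partial>\<gamma>) \<le> M * \<delta>" by (simp add: algebra_simps)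
  then have small: "R * (\<integral>z. min 1 (D z) \<partial>\<gamma>) \<le> \<epsilon> / 2"
    using s R M by (simp add: \<delta>_def field_simps)
  have "integrable Q (\<lambda>\<xi>. if R < g \<xi> then g \<xi> else 0)"
    using g by (rule Bochner_Integration.integrable_bound) (use g in auto)
  note tail = integrable_coupling_fst[OF \<gamma>(1) this] integral_coupling_fst[OF \<gamma>(1) this]
  have "0 \<le> s * (\<integral>z. min 1 (D z) \<partial>\<gamma>)" using s D0 by (simp add: integral_nonneg_AE)
  then have "M * \<epsilon> \<le> M * (\<integral>z. D z \<partial>\<gamma>)" using gap by simp
  then have "\<epsilon> \<le> (\<integral>z. D z \<partial>\<gamma>)" using M by simp
  also have "\<dots> \<le> (\<integral>z. R * min 1 (D z) + (if R < g (fst z) then g (fst z) else 0) \<partial>\<gamma>)"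
  proof (intro integral_mono_AE)
    show "AE z in \<gamma>. D z \<le> R * min 1 (D z) + (if R < g (fst z) then g (fst z) else 0)"
      using AE
    proof eventually_elim
      case (elim z)
      have nn: "0 \<le> D z" "D z \<le> g (fst z)" using dist_le[OF elim] by (auto simp: D_def)
      then have "0 \<le> R * min 1 (D z)" using R by simp
      moreover have "D z \<le> R * min 1 (D z)" if "D z \<le> R"
        using that nn R mult_right_mono[of 1 R "D z"] by (auto simp: min_def)
      ultimately show ?case using nn by (cases "R < g (fst z)") auto
    qed
  qed (use D D1 tail in auto)
  also have "\<dots> = R * (\<integral>z. min 1 (D z) \<partial>\<gamma>) + (\<integral>\<xi>. (if R < g \<xi> then g \<xi> else 0) \<partial>Q)"
    using D1 tail by simp
  also have "\<dots> < \<epsilon>" using small R(2) by simp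
  finally show False by simp
qed

section \<open>Reallocating mass at one sample point\<close>

lemma AE_empirical:
  fixes \<zeta> :: "nat \<Rightarrow> real ^ 'k"
  assumes "\<And>i. i \<in> {1..N} \<Longrightarrow> \<zeta> i \<in> \<Xi>"
  shows "AE a in empirical \<Xi> N \<zeta>. a \<in> \<zeta> ` {1..N}"
proof -
  have "closed (\<zeta> ` {1..N})" by (simp add: finite_imp_closed)
  then have "{a \<in> space (borel_on \<Xi>). a \<in> \<zeta> ` {1..N}} \<in> sets (borel_on \<Xi>)"
    by (auto simp: sets_restrict_space space_restrict_space Int_def borel_closed
        intro!: image_eqI[of _ _ "\<zeta> ` {1..N}"])
  then show ?thesis
    unfolding empirical_def dirac_mixture_def using assms
    by (subst AE_distr_iff) (auto simp: AE_point_measure space_restrict_space)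
qed

lemma empirical_prob_with_moment:
  assumes "1 \<le> p" "1 \<le> N" "\<And>i. i \<in> {1..N} \<Longrightarrow> \<zeta> i \<in> \<Xi>"
  shows "empirical \<Xi> N \<zeta> \<in> prob_with_moment p r \<Xi>"
  unfolding empirical_def using assms by (intro dirac_mixture_prob_with_moment) auto

lemma shifted_distribution_in_ambiguity_set:
  assumes p: "1 \<le> p" and N: "1 \<le> N" and \<zeta>: "\<And>i. i \<in> {1..N} \<Longrightarrow> \<zeta> i \<in> \<Xi>" and \<epsilon>: "0 \<le> \<epsilon>"
    and i: "i' \<in> {1..N}" and d: "lp_norm p d = 1" "\<zeta> i' + (\<epsilon> * real N) *\<^sub>R d \<in> \<Xi>"
  shows "shifted_distribution \<Xi> N \<zeta> \<epsilon> i' d \<in> ambiguity_set p 1 \<Xi> N \<zeta> \<epsilon>"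
proof -
  let ?z = "\<zeta>(i' := \<zeta> i' + (\<epsilon> * real N) *\<^sub>R d)"
  have z: "?z i \<in> \<Xi>" if "i \<in> {1..N}" for i using that \<zeta> d by simp
  have "wasserstein p 1 (shifted_distribution \<Xi> N \<zeta> \<epsilon> i' d) (empirical \<Xi> N \<zeta>)
      \<le> ennreal (\<Sum>i\<in>{1..N}. 1 / real N * lp_norm p (?z i - \<zeta> i))"
    unfolding shifted_distribution_def empirical_def
    using N z \<zeta> p by (intro wasserstein_dirac_mixture_le) auto
  also have "(\<Sum>i\<in>{1..N}. 1 / real N * lp_norm p (?z i - \<zeta> i))
      = (\<Sum>i\<in>{1..N}. if i = i' then \<epsilon> else 0)"
    using N \<epsilon> d p lp_norm_scaleR[OF p, of 0 0]
    by (intro sum.cong) (auto simp: lp_norm_scaleR)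
  also have "\<dots> = \<epsilon>" using i by simp
  finally show ?thesis
    unfolding ambiguity_set_def using N z p
    by (auto simp: shifted_distribution_def intro!: dirac_mixture_prob_with_moment)
qed

lemma integral_shifted_distribution:
  fixes f :: "real ^ 'k \<Rightarrow> real"
  assumes f: "f \<in> borel_measurable borel" and \<zeta>: "\<And>i. i \<in> {1..N} \<Longrightarrow> \<zeta> i \<in> \<Xi>"
    and i: "i' \<in> {1..N}" and d: "\<zeta> i' + (\<epsilon> * real N) *\<^sub>R d \<in> \<Xi>"
  shows "(\<integral>\<xi>. f \<xi> \<partial>shifted_distribution \<Xi> N \<zeta> \<epsilon> i' d)
    = (\<integral>\<xi>. f \<xi> \<partial>empirical \<Xi> N \<zeta>) + (f (\<zeta> i' + (\<epsilon> * real N) *\<^sub>R d) - f (\<zeta> i')) / real N"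
proof -
  have "(\<integral>\<xi>. f \<xi> \<partial>shifted_distribution \<Xi> N \<zeta> \<epsilon> i' d)
      = (\<Sum>i\<in>{1..N}. 1 / real N * f ((\<zeta>(i' := \<zeta> i' + (\<epsilon> * real N) *\<^sub>R d)) i))"
    unfolding shifted_distribution_def using assms by (intro integral_dirac_mixture) auto
  also have "\<dots> = (\<Sum>i\<in>{1..N}. 1 / real N * f (\<zeta> i)
      + (if i = i' then (f (\<zeta> i' + (\<epsilon> * real N) *\<^sub>R d) - f (\<zeta> i')) / real N else 0))"
    by (intro sum.cong) (auto simp: diff_divide_distrib)
  also have "\<dots> = (\<Sum>i\<in>{1..N}. 1 / real N * f (\<zeta> i))
      + (f (\<zeta> i' + (\<epsilon> * real N) *\<^sub>R d) - f (\<zeta> i')) / real N"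
    using i by (simp add: sum.distrib)
  also have "(\<Sum>i\<in>{1..N}. 1 / real N * f (\<zeta> i)) = (\<integral>\<xi>. f \<xi> \<partial>empirical \<Xi> N \<zeta>)"
    unfolding empirical_def using assms by (intro integral_dirac_mixture[symmetric]) auto
  finally show ?thesis .
qed

text \<open>Index \<open>0\<close> takes the mass \<open>\<Delta>\<close> from index \<open>i'\<close>, so a weighted sum changes by the difference of the
  two values.\<close>

lemma sum_atLeast0_split_weights:
  fixes h :: "nat \<Rightarrow> real"
  assumes "i' \<in> {1..N}"
  shows "(\<Sum>i\<in>{0..N}. ((\<lambda>_. u)(i' := u - \<Delta>, 0 := \<Delta>)) i * h i)
    = (\<Sum>i\<in>{1..N}. u * h i) + \<Delta> * (h 0 - h i')"
proof -
  have "{0..N} = insert 0 {1..N}" by auto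
  then have "(\<Sum>i\<in>{0..N}. ((\<lambda>_. u)(i' := u - \<Delta>, 0 := \<Delta>)) i * h i)
      = \<Delta> * h 0 + (\<Sum>i\<in>{1..N}. ((\<lambda>_. u)(i' := u - \<Delta>, 0 := \<Delta>)) i * h i)" by simp
  also have "(\<Sum>i\<in>{1..N}. ((\<lambda>_. u)(i' := u - \<Delta>, 0 := \<Delta>)) i * h i)
      = (\<Sum>i\<in>{1..N}. u * h i + (if i = i' then - \<Delta> * h i' else 0))"
    by (intro sum.cong) (auto simp: algebra_simps)
  also have "\<dots> = (\<Sum>i\<in>{1..N}. u * h i) - \<Delta> * h i'"
    using assms by (simp add: sum.distrib)
  finally have eq: "(\<Sum>i\<in>{0..N}. ((\<lambda>_. u)(i' := u - \<Delta>, 0 := \<Delta>)) i * h i)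
      = \<Delta> * h 0 + ((\<Sum>i\<in>{1..N}. u * h i) - \<Delta> * h i')" .
  show ?thesis unfolding eq by (simp add: right_diff_distrib)
qed

text \<open>The empirical distribution with the atom at \<open>i'\<close> split into two coincident atoms of masses
  \<open>1 / N - \<Delta>\<close> and \<open>\<Delta>\<close>. In this form it has the weights of \<open>split_distribution\<close>, and the two can be
  coupled atom by atom.\<close>

lemma empirical_split:
  assumes \<zeta>: "\<And>i. i \<in> {1..N} \<Longrightarrow> \<zeta> i \<in> \<Xi>" and i: "i' \<in> {1..N}" and \<Delta>: "0 \<le> \<Delta>" "\<Delta> \<le> 1 / real N"
  shows "empirical \<Xi> N \<zeta> =
    dirac_mixture \<Xi> {0..N} ((\<lambda>_. 1 / real N)(i' := 1 / real N - \<Delta>, 0 := \<Delta>)) (\<zeta>(0 := \<zeta> i'))"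
    (is "_ = dirac_mixture _ _ ?w ?z")
proof (rule measure_eqI)
  fix A assume "A \<in> sets (empirical \<Xi> N \<zeta>)"
  then have A: "A \<in> sets (borel_on \<Xi>)" by (simp add: empirical_def)
  let ?h = "\<lambda>i. indicator A (?z i) :: real"
  have w: "0 \<le> ?w i" for i using \<Delta> by simp
  have z: "?z i \<in> \<Xi>" if "i \<in> {0..N}" for i using that \<zeta> i by (cases "i = 0") auto
  have "emeasure (dirac_mixture \<Xi> {0..N} ?w ?z) A
      = (\<Sum>i\<in>{0..N}. ennreal (?w i) * emeasure (return (borel_on \<Xi>) (?z i)) A)"
    using z A by (intro emeasure_dirac_mixture) auto
  also have "\<dots> = (\<Sum>i\<in>{0..N}. ennreal (?w i * ?h i))"
    using A w by (intro sum.cong) (auto simp: ennreal_mult ennreal_indicator simp del: fun_upd_apply)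
  also have "\<dots> = ennreal (\<Sum>i\<in>{0..N}. ?w i * ?h i)"
    using w by (intro sum_ennreal) (auto simp del: fun_upd_apply)
  also have "(\<Sum>i\<in>{0..N}. ?w i * ?h i) = (\<Sum>i\<in>{1..N}. 1 / real N * ?h i)"
    using sum_atLeast0_split_weights[OF i, of "1 / real N" \<Delta> ?h] i by simp
  also have "ennreal \<dots> = (\<Sum>i\<in>{1..N}. ennreal (1 / real N * ?h i))"
    by (intro sum_ennreal[symmetric]) auto
  also have "\<dots> = (\<Sum>i\<in>{1..N}. ennreal (1 / real N) * emeasure (return (borel_on \<Xi>) (\<zeta> i)) A)"
    using A by (intro sum.cong) (auto simp: ennreal_mult ennreal_indicator indicator_def)
  also have "\<dots> = emeasure (empirical \<Xi> N \<zeta>) A"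
    unfolding empirical_def using \<zeta> A by (intro emeasure_dirac_mixture[symmetric]) auto
  finally show "emeasure (empirical \<Xi> N \<zeta>) A = emeasure (dirac_mixture \<Xi> {0..N} ?w ?z) A" ..
qed (simp add: empirical_def)

lemma split_distribution_in_ambiguity_set:
  assumes p: "1 \<le> p" and N: "1 \<le> N" and \<zeta>: "\<And>i. i \<in> {1..N} \<Longrightarrow> \<zeta> i \<in> \<Xi>" and \<epsilon>: "0 \<le> \<epsilon>"
    and i: "i' \<in> {1..N}" and \<Delta>: "0 < \<Delta>" "\<Delta> \<le> 1 / real N"
    and d: "lp_norm p d = 1" "\<zeta> i' + (\<epsilon> / \<Delta>) *\<^sub>R d \<in> \<Xi>"
  shows "split_distribution \<Xi> N \<zeta> \<epsilon> i' d \<Delta> \<in> ambiguity_set p 1 \<Xi> N \<zeta> \<epsilon>"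
proof -
  let ?w = "(\<lambda>_. 1 / real N)(i' := 1 / real N - \<Delta>, 0 := \<Delta>)"
  let ?z = "\<zeta>(0 := \<zeta> i' + (\<epsilon> / \<Delta>) *\<^sub>R d)" and ?z' = "\<zeta>(0 := \<zeta> i')"
  have w: "0 \<le> ?w j" for j using \<Delta> by simp
  have z: "?z j \<in> \<Xi>" "?z' j \<in> \<Xi>" if "j \<in> {0..N}" for j
    using that \<zeta> i d by (cases "j = 0"; auto)+
  have sum: "sum ?w {0..N} = 1"
    using sum_atLeast0_split_weights[OF i, of "1 / real N" \<Delta> "\<lambda>_. 1"] N by simp
  have emp: "empirical \<Xi> N \<zeta> = dirac_mixture \<Xi> {0..N} ?w ?z'"
    using \<zeta> i \<Delta> by (intro empirical_split) auto
  have "wasserstein p 1 (split_distribution \<Xi> N \<zeta> \<epsilon> i' d \<Delta>) (empirical \<Xi> N \<zeta>)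
      \<le> ennreal (\<Sum>j\<in>{0..N}. ?w j * lp_norm p (?z j - ?z' j))"
    unfolding split_distribution_def emp
    using z w sum p by (intro wasserstein_dirac_mixture_le) (auto simp del: fun_upd_apply)
  also have "(\<Sum>j\<in>{0..N}. ?w j * lp_norm p (?z j - ?z' j)) = (\<Sum>j\<in>{0..N}. if j = 0 then \<epsilon> else 0)"
    using i \<Delta> \<epsilon> d lp_norm_scaleR[OF p, of 0 0] p
    by (intro sum.cong) (auto simp: lp_norm_scaleR)
  also have "\<dots> = \<epsilon>" by simp
  finally show ?thesis
    unfolding ambiguity_set_def using z w sum p
    by (auto simp: split_distribution_def simp del: fun_upd_apply
        intro!: dirac_mixture_prob_with_moment)
qed

lemma integral_split_distribution:
  fixes f :: "real ^ 'k \<Rightarrow> real"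
  assumes f: "f \<in> borel_measurable borel" and \<zeta>: "\<And>i. i \<in> {1..N} \<Longrightarrow> \<zeta> i \<in> \<Xi>"
    and i: "i' \<in> {1..N}" and \<Delta>: "0 < \<Delta>" "\<Delta> \<le> 1 / real N"
    and d: "\<zeta> i' + (\<epsilon> / \<Delta>) *\<^sub>R d \<in> \<Xi>"
  shows "(\<integral>\<xi>. f \<xi> \<partial>split_distribution \<Xi> N \<zeta> \<epsilon> i' d \<Delta>)
    = (\<integral>\<xi>. f \<xi> \<partial>empirical \<Xi> N \<zeta>) + \<Delta> * (f (\<zeta> i' + (\<epsilon> / \<Delta>) *\<^sub>R d) - f (\<zeta> i'))"
proof -
  let ?w = "(\<lambda>_. 1 / real N)(i' := 1 / real N - \<Delta>, 0 := \<Delta>)"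
  let ?z = "\<zeta>(0 := \<zeta> i' + (\<epsilon> / \<Delta>) *\<^sub>R d)"
  have w: "0 \<le> ?w j" for j using \<Delta> by simp
  have z: "?z j \<in> \<Xi>" if "j \<in> {0..N}" for j using that \<zeta> d by (cases "j = 0") auto
  have "(\<integral>\<xi>. f \<xi> \<partial>split_distribution \<Xi> N \<zeta> \<epsilon> i' d \<Delta>) = (\<Sum>j\<in>{0..N}. ?w j * f (?z j))"
    unfolding split_distribution_def
    using z w f by (intro integral_dirac_mixture) (auto simp del: fun_upd_apply)
  also have "\<dots> = (\<Sum>j\<in>{1..N}. 1 / real N * f (\<zeta> j)) + \<Delta> * (f (\<zeta> i' + (\<epsilon> / \<Delta>) *\<^sub>R d) - f (\<zeta> i'))"
    using sum_atLeast0_split_weights[OF i, of "1 / real N" \<Delta> "\<lambda>j. f (?z j)"] i by simp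
  also have "(\<Sum>j\<in>{1..N}. 1 / real N * f (\<zeta> j)) = (\<integral>\<xi>. f \<xi> \<partial>empirical \<Xi> N \<zeta>)"
    unfolding empirical_def using assms by (intro integral_dirac_mixture[symmetric]) auto
  finally show ?thesis .
qed

section \<open>Worst-case distributions\<close>

lemma argmax_set_iff:
  assumes "a \<in> S" "\<And>b. b \<in> S \<Longrightarrow> g b \<le> (g a :: real)"
  shows "b \<in> argmax_set g S \<longleftrightarrow> b \<in> S \<and> g b = g a"
proof -
  have "b \<in> argmax_set g S \<longleftrightarrow> b \<in> S \<and> (\<forall>b'\<in>S. g b' \<le> g b)"
    by (auto simp: argmax_set_def is_arg_max_def not_less)
  then show ?thesis using assms by (auto intro: order.antisym)
qed

theorem proposition3:
  fixes K :: "(real ^ 'ny) set"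
    and c :: "real ^ 'ny"
    and W :: "real ^ 'ny ^ 'k"
    and T :: "real ^ 'nx ^ 'k"
    and x :: "real ^ 'nx"
    and p q :: ereal
    and \<Xi> :: "(real ^ 'k) set"
    and N :: nat
    and \<zeta> :: "nat \<Rightarrow> real ^ 'k"
    and \<epsilon> :: real
  defines "Z \<equiv> second_stage_cost c W T K"
    and "Pi_max \<equiv> argmax_set (lp_norm q) (dual_feasible c W K)"
    and "Pi_opt \<equiv> (\<lambda>i. argmax_set (\<lambda>\<pi>. \<pi> \<bullet> (T *v x + \<zeta> i)) (dual_feasible c W K))"
    and "\<P> \<equiv> ambiguity_set p 1 \<Xi> N \<zeta> \<epsilon>"
  assumes "product_of_proper_cones K"
    and "complete_recourse W K"
    and "interior (dual_feasible c W K) \<noteq> {}"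
    and "1 \<le> p" and "1 \<le> q" and "1 / p + 1 / q = 1"
    and "\<Xi> = UNIV \<or> \<Xi> = {\<xi>. 0 \<le> \<xi>}"
    and "1 \<le> N" and "\<forall>i\<in>{1..N}. \<zeta> i \<in> \<Xi>"
    and "0 < \<epsilon>"
  shows
    "(\<forall>i'\<in>{1..N}. \<forall>\<pi>\<in>Pi_max \<inter> Pi_opt i'.
        attains_worst_case \<P> (Z x) (shifted_distribution \<Xi> N \<zeta> \<epsilon> i' (direction q \<pi>)))
     \<and>
     ((\<forall>i\<in>{1..N}. Pi_max \<inter> Pi_opt i = {}) \<longrightarrow>
        (\<nexists>Q. attains_worst_case \<P> (Z x) Q) \<and>
        (\<exists>i'\<in>{1..N}. \<exists>\<pi>\<in>Pi_max.
           (\<forall>\<Delta>\<in>{0<..1 / real N}. split_distribution \<Xi> N \<zeta> \<epsilon> i' (direction q \<pi>) \<Delta> \<in> \<P>) \<and>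
           ((\<lambda>\<Delta>. ereal (\<integral>\<xi>. Z x \<xi> \<partial>split_distribution \<Xi> N \<zeta> \<epsilon> i' (direction q \<pi>) \<Delta>))
              \<longlongrightarrow> worst_case \<P> (Z x)) (at_right 0)))"
proof -
  let ?D = "dual_feasible c W K"
  define f where "f = Z x"
  note p = \<open>1 \<le> p\<close> and pq = \<open>1 \<le> p\<close> \<open>1 \<le> q\<close> \<open>1 / p + 1 / q = 1\<close>
    and N = \<open>1 \<le> N\<close> and \<epsilon> = \<open>0 < \<epsilon>\<close>
  have \<zeta>: "\<zeta> i \<in> \<Xi>" if "i \<in> {1..N}" for i using \<open>\<forall>i\<in>{1..N}. \<zeta> i \<in> \<Xi>\<close> that by blast
  have ne: "?D \<noteq> {}" using \<open>interior ?D \<noteq> {}\<close> interior_subset by fastforce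
  have cone: "convex_cone K"
    using \<open>product_of_proper_cones K\<close> by (rule convex_cone_product_of_proper_cones)
  have cpt: "compact ?D" using \<open>complete_recourse W K\<close> by (rule compact_dual_feasible)
  have le: "\<pi> \<bullet> (T *v x + \<xi>) \<le> f \<xi>" if "\<pi> \<in> ?D" for \<pi> \<xi>
    unfolding f_def Z_def
    by (rule second_stage_strong_duality(1)[OF cone \<open>complete_recourse W K\<close> ne that])
  have att: "\<exists>\<pi>\<in>?D. f \<xi> = \<pi> \<bullet> (T *v x + \<xi>)" for \<xi>
    unfolding f_def Z_def
    by (rule second_stage_strong_duality(2)[OF cone \<open>complete_recourse W K\<close> ne])
  have "continuous_on ?D (lp_norm q)" by (intro continuous_intros pq)
  then obtain \<pi>0 where \<pi>0: "\<pi>0 \<in> ?D" "\<And>\<pi>. \<pi> \<in> ?D \<Longrightarrow> lp_norm q \<pi> \<le> lp_norm q \<pi>0"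
    using continuous_attains_sup[OF cpt ne] by metis
  define M where "M = lp_norm q \<pi>0"
  have M: "lp_norm q \<pi> \<le> M" if "\<pi> \<in> ?D" for \<pi> using \<pi>0(2)[OF that] by (simp add: M_def)
  have Pi_max: "\<pi> \<in> Pi_max \<longleftrightarrow> \<pi> \<in> ?D \<and> lp_norm q \<pi> = M" for \<pi>
    unfolding Pi_max_def M_def by (intro argmax_set_iff \<pi>0)
  have Pi_opt: "\<pi> \<in> Pi_opt i \<longleftrightarrow> \<pi> \<in> ?D \<and> \<pi> \<bullet> (T *v x + \<zeta> i) = f (\<zeta> i)" for \<pi> i
  proof -
    obtain \<pi>1 where \<pi>1: "\<pi>1 \<in> ?D" "f (\<zeta> i) = \<pi>1 \<bullet> (T *v x + \<zeta> i)" using att by blast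
    show ?thesis
      unfolding Pi_opt_def \<pi>1(2) using le[of _ "\<zeta> i"] \<pi>1(2) by (intro argmax_set_iff \<pi>1(1)) simp
  qed
  \<comment> \<open>A set with interior points is not \<open>{0}\<close>.\<close>
  have M_pos: "0 < M"
  proof -
    have "\<not> ?D \<subseteq> {0}"
      using \<open>interior ?D \<noteq> {}\<close> interior_mono[of ?D "{0}"] by auto
    then obtain \<pi> where "\<pi> \<in> ?D" "\<pi> \<noteq> 0" by blast
    then show ?thesis using M[of \<pi>] lp_norm_pos_iff[OF pq(2), of \<pi>] by linarith
  qed
  have L: "f z - f a \<le> M * lp_norm p (z - a)" for z a
    by (rule support_function_lipschitz[OF pq att le M])
  have f_meas: "f \<in> borel_measurable borel"
    using continuous_on_lp_lipschitz[OF p less_imp_le[OF M_pos] L]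
    by (rule borel_measurable_continuous_onI)
  have emp: "empirical \<Xi> N \<zeta> \<in> prob_with_moment p 1 \<Xi>"
    using empirical_prob_with_moment[OF p N \<zeta>] .
  define U where "U = (\<integral>\<xi>. f \<xi> \<partial>empirical \<Xi> N \<zeta>) + M * \<epsilon>"
  have upper: "(\<integral>\<xi>. f \<xi> \<partial>Q) \<le> U" if "Q \<in> \<P>" for Q
    unfolding U_def using that \<epsilon>
    by (intro kantorovich_upper_bound[OF p less_imp_le[OF M_pos] L _ emp])
      (auto simp: \<P>_def ambiguity_set_def)
  then have wc_le: "worst_case \<P> f \<le> ereal U"
    unfolding worst_case_def by (intro SUP_least) simp
  have dir: "lp_norm p (direction q \<pi>) = 1" "\<pi> \<bullet> direction q \<pi> = M"
    if "\<pi> \<in> Pi_max" for \<pi>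
  proof -
    have "0 \<le> \<pi>" "\<pi> \<noteq> 0"
      using that M_pos lp_norm_pos_iff[OF pq(2), of \<pi>] by (auto simp: Pi_max dual_feasible_iff)
    then show "lp_norm p (direction q \<pi>) = 1" "\<pi> \<bullet> direction q \<pi> = M"
      using lp_norm_direction[OF pq] inner_direction[OF pq] that by (auto simp: Pi_max)
  qed
  have ray: "\<zeta> i + t *\<^sub>R direction q \<pi> \<in> \<Xi>" if "i \<in> {1..N}" "0 \<le> t" for i t \<pi>
    using \<open>\<Xi> = UNIV \<or> \<Xi> = {\<xi>. 0 \<le> \<xi>}\<close> \<zeta>[OF that(1)] direction_nonneg[of q \<pi>] that(2)
    by (auto simp: less_eq_vec_def)
  \<comment> \<open>Along the ray of a norm-maximising \<open>\<pi>\<close> the cost grows with the full slope \<open>M\<close>, up to the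
    deficit of \<open>\<pi>\<close> at the sample point.\<close>
  have lower: "\<pi> \<bullet> (T *v x + \<zeta> i) + t * M \<le> f (\<zeta> i + t *\<^sub>R direction q \<pi>)"
    if "\<pi> \<in> Pi_max" for \<pi> i t
    using le[of \<pi> "\<zeta> i + t *\<^sub>R direction q \<pi>"] dir(2)[OF that] that
    by (simp add: Pi_max inner_simps)
  have attainable: "attains_worst_case \<P> f (shifted_distribution \<Xi> N \<zeta> \<epsilon> i' (direction q \<pi>))"
    if i: "i' \<in> {1..N}" and \<pi>: "\<pi> \<in> Pi_max" "\<pi> \<in> Pi_opt i'" for i' \<pi>
  proof -
    let ?Q = "shifted_distribution \<Xi> N \<zeta> \<epsilon> i' (direction q \<pi>)"
    have r: "\<zeta> i' + (\<epsilon> * real N) *\<^sub>R direction q \<pi> \<in> \<Xi>" using i \<epsilon> by (intro ray) auto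
    have Q: "?Q \<in> \<P>"
      unfolding \<P>_def using p N \<zeta> \<epsilon> i dir(1)[OF \<pi>(1)] r
      by (intro shifted_distribution_in_ambiguity_set) auto
    have "\<epsilon> * real N * M \<le> f (\<zeta> i' + (\<epsilon> * real N) *\<^sub>R direction q \<pi>) - f (\<zeta> i')"
      using lower[OF \<pi>(1), of i' "\<epsilon> * real N"] \<pi>(2) by (simp add: Pi_opt)
    then have "\<epsilon> * real N * M / real N
        \<le> (f (\<zeta> i' + (\<epsilon> * real N) *\<^sub>R direction q \<pi>) - f (\<zeta> i')) / real N"
      by (rule divide_right_mono) simp
    then have "U \<le> (\<integral>\<xi>. f \<xi> \<partial>?Q)"
      using N integral_shifted_distribution[where \<zeta> = \<zeta> and \<epsilon> = \<epsilon> and d = "direction q \<pi>",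
          OF f_meas \<zeta> i r] by (simp add: U_def mult.commute)
    then have "(\<integral>\<xi>. f \<xi> \<partial>?Q) = U" using upper[OF Q] by simp
    moreover have "ereal (\<integral>\<xi>. f \<xi> \<partial>?Q) \<le> worst_case \<P> f"
      unfolding worst_case_def using Q by (intro SUP_upper)
    ultimately show ?thesis using wc_le Q by (simp add: attains_worst_case_def antisym)
  qed
  have asymptotic: "(\<forall>\<Delta>\<in>{0<..1 / real N}. split_distribution \<Xi> N \<zeta> \<epsilon> i (direction q \<pi>) \<Delta> \<in> \<P>)"
    "((\<lambda>\<Delta>. \<integral>\<xi>. f \<xi> \<partial>split_distribution \<Xi> N \<zeta> \<epsilon> i (direction q \<pi>) \<Delta>) \<longlongrightarrow> U) (at_right 0)"
    if i: "i \<in> {1..N}" and \<pi>: "\<pi> \<in> Pi_max" for i \<pi>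
  proof -
    let ?Q = "split_distribution \<Xi> N \<zeta> \<epsilon> i (direction q \<pi>)"
    have r: "\<zeta> i + (\<epsilon> / \<Delta>) *\<^sub>R direction q \<pi> \<in> \<Xi>" if "0 < \<Delta>" for \<Delta>
      using i \<epsilon> that by (intro ray) auto
    show Q: "\<forall>\<Delta>\<in>{0<..1 / real N}. ?Q \<Delta> \<in> \<P>"
      unfolding \<P>_def using p N \<zeta> \<epsilon> i dir(1)[OF \<pi>] r
      by (intro ballI split_distribution_in_ambiguity_set) auto
    define l where "l \<Delta> = U + \<Delta> * (\<pi> \<bullet> (T *v x + \<zeta> i) - f (\<zeta> i))" for \<Delta>
    have l: "l \<Delta> \<le> (\<integral>\<xi>. f \<xi> \<partial>?Q \<Delta>)" if \<Delta>: "0 < \<Delta>" "\<Delta> \<le> 1 / real N" for \<Delta>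
    proof -
      have "\<Delta> * (\<pi> \<bullet> (T *v x + \<zeta> i) + \<epsilon> / \<Delta> * M - f (\<zeta> i))
          \<le> \<Delta> * (f (\<zeta> i + (\<epsilon> / \<Delta>) *\<^sub>R direction q \<pi>) - f (\<zeta> i))"
        using lower[OF \<pi>, of i "\<epsilon> / \<Delta>"] \<Delta> by (intro mult_left_mono) auto
      then show ?thesis
        using integral_split_distribution[where \<zeta> = \<zeta> and \<epsilon> = \<epsilon> and d = "direction q \<pi>",
            OF f_meas \<zeta> i \<Delta> r[OF \<Delta>(1)]] \<Delta>
        by (simp add: l_def U_def algebra_simps)
    qed
    have ev: "\<forall>\<^sub>F \<Delta> in at_right 0. 0 < \<Delta> \<and> \<Delta> \<le> 1 / real N"
      using N by (auto simp: eventually_at_right_field intro!: exI[of _ "1 / real N"])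
    show "((\<lambda>\<Delta>. \<integral>\<xi>. f \<xi> \<partial>?Q \<Delta>) \<longlongrightarrow> U) (at_right 0)"
    proof (rule tendsto_sandwich)
      show "\<forall>\<^sub>F \<Delta> in at_right 0. l \<Delta> \<le> (\<integral>\<xi>. f \<xi> \<partial>?Q \<Delta>)"
        using ev by eventually_elim (simp add: l)
      show "\<forall>\<^sub>F \<Delta> in at_right 0. (\<integral>\<xi>. f \<xi> \<partial>?Q \<Delta>) \<le> U"
        using ev by eventually_elim (use Q upper in auto)
      show "(l \<longlongrightarrow> U) (at_right 0)" unfolding l_def by (auto intro!: tendsto_eq_intros)
    qed simp
  qed
  have \<pi>0_max: "\<pi>0 \<in> Pi_max" using \<pi>0 by (simp add: Pi_max M_def)
  have one: "1 \<in> {1..N}" using N by simp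
  note split = asymptotic[OF one \<pi>0_max]
  \<comment> \<open>Any sample point will do: the deficit of \<open>\<pi>0\<close> disappears in the limit.\<close>
  have "ereal U \<le> worst_case \<P> f"
  proof (rule tendsto_upperbound)
    show "((\<lambda>\<Delta>. ereal (\<integral>\<xi>. f \<xi> \<partial>split_distribution \<Xi> N \<zeta> \<epsilon> 1 (direction q \<pi>0) \<Delta>)) \<longlongrightarrow> ereal U) (at_right 0)"
      using split(2) by simp
    have "\<forall>\<^sub>F \<Delta> in at_right 0. 0 < \<Delta> \<and> \<Delta> \<le> 1 / real N"
      using N by (auto simp: eventually_at_right_field intro!: exI[of _ "1 / real N"])
    then show "\<forall>\<^sub>F \<Delta> in at_right 0.
        ereal (\<integral>\<xi>. f \<xi> \<partial>split_distribution \<Xi> N \<zeta> \<epsilon> 1 (direction q \<pi>0) \<Delta>) \<le> worst_case \<P> f"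
      unfolding worst_case_def by eventually_elim (use split(1) in \<open>auto intro!: SUP_upper\<close>)
  qed simp
  then have wc: "worst_case \<P> f = ereal U" using wc_le by simp
  have not_attained: "\<not> attains_worst_case \<P> f Q"
    if disj: "\<forall>i\<in>{1..N}. Pi_max \<inter> Pi_opt i = {}" for Q
  proof
    assume Q: "attains_worst_case \<P> f Q"
    have "\<exists>s>0. \<forall>z. f z - f a \<le> M * lp_norm p (z - a) - s * min 1 (lp_norm p (z - a))"
      if "a \<in> \<zeta> ` {1..N}" for a
    proof -
      have "\<not> (lp_norm q \<pi> = M \<and> \<pi> \<bullet> (T *v x + a) = f a)" if "\<pi> \<in> ?D" for \<pi>
        using disj \<open>a \<in> \<zeta> ` {1..N}\<close> that by (auto simp: Pi_max Pi_opt disjoint_iff)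
      then obtain s where "0 < s"
        "\<And>z. f z - f a \<le> M * lp_norm p (z - a) - s * min 1 (lp_norm p (z - a))"
        using support_function_slack[where f = f and a = a, OF pq cpt att le M] by metis
      then show ?thesis by blast
    qed
    then obtain s where s: "\<And>a. a \<in> \<zeta> ` {1..N} \<Longrightarrow> 0 < s a"
      "\<And>a z. a \<in> \<zeta> ` {1..N} \<Longrightarrow>
        f z - f a \<le> M * lp_norm p (z - a) - s a * min 1 (lp_norm p (z - a))"
      by metis
    define s0 where "s0 = Min (s ` \<zeta> ` {1..N})"
    have "0 < s0" unfolding s0_def using N s(1) by (subst Min_gr_iff) auto
    moreover have "f z - f a \<le> M * lp_norm p (z - a) - s0 * min 1 (lp_norm p (z - a))"
      if a: "a \<in> \<zeta> ` {1..N}" for z a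
    proof -
      have "s0 \<le> s a" unfolding s0_def using a by (intro Min_le) auto
      then have "s0 * min 1 (lp_norm p (z - a)) \<le> s a * min 1 (lp_norm p (z - a))"
        by (intro mult_right_mono) auto
      then show ?thesis using s(2)[OF a, of z] by linarith
    qed
    moreover have "Q \<in> prob_with_moment p 1 \<Xi>" "wasserstein p 1 Q (empirical \<Xi> N \<zeta>) \<le> ennreal \<epsilon>"
      using Q by (auto simp: attains_worst_case_def \<P>_def ambiguity_set_def)
    ultimately have "(\<integral>\<xi>. f \<xi> \<partial>Q) < U"
      unfolding U_def
      using kantorovich_bound_strict[OF p M_pos L _ AE_empirical[OF \<zeta>] _ _ _ emp _ \<epsilon>] by blast
    then show False using Q wc by (simp add: attains_worst_case_def)
  qed
  show ?thesis
    unfolding f_def[symmetric] wc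
    using attainable not_attained split one \<pi>0_max by (auto intro!: bexI[of _ 1] bexI[of _ \<pi>0])
qed

end
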